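(* Let $(x_n)_{n\ge1}$ be a sequence of real numbers (considered modulo 1) with discrepancy $D_N$, and let $M_N=\max_{n\le N} nD_n$. Let $g:(0,\infty)\to(0,\infty)$ be monotonically decreasing with $\lim_{N\to\infty} g(N)/D_N=\infty$, $\lim_{N\to\infty} N g(N)=\infty$, and $$\lim_{N\to\infty}\frac{g\!\left(N\left(1+\frac{M_N}{N g(N)}\right)\right)}{g(N)}=1.$$ Let $z_1,z_2,\dots$ be independent random variables with $z_i$ uniformly distributed on $[-g(i),g(i)]$. Then, almost surely, the sequence $(x_n+z_n)_{n\ge1}$ has Poissonian pair correlation.
   Context: $\{x\}$ denotes the fractional part of $x$ and $\|x\|$ the distance from $x$ to the nearest integer. The discrepancy of $(x_n)$ is $D_N=\sup_{0\le a\le b\le 1}\left|\frac{\#\{n\le N:\{x_n\}\in[a,b]\}}{N}-(b-a)\right|$. A real sequence $(y_n)_{n\ge1}$ has Poissonian pair correlation if for every $s>0$, $\lim_{N\to\infty}\frac1N\#\{(m,n): 1\le m\ne n\le N,\ \|y_m-y_n\|<s/N\}=2s$. *)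

theory Defs
  imports "HOL-Probability.Probability"
begin

definition dist_int :: "real \<Rightarrow> real" where
  "dist_int x = \<bar>x - of_int (round x)\<bar>"

definition discrepancy :: "(nat \<Rightarrow> real) \<Rightarrow> nat \<Rightarrow> real" where
  "discrepancy x N = Sup {\<bar>real (card {n \<in> {1..N}. frac (x n) \<in> {a..b}}) / real N - (b - a)\<bar>
                          | a b. 0 \<le> a \<and> a \<le> b \<and> b \<le> 1}"

definition max_nD :: "(nat \<Rightarrow> real) \<Rightarrow> nat \<Rightarrow> real" where
  "max_nD x N = Max ((\<lambda>n. real n * discrepancy x n) ` {1..N})"

definition poissonian_pair_correlation :: "(nat \<Rightarrow> real) \<Rightarrow> bool" where
  "poissonian_pair_correlation y \<longleftrightarrow>
     (\<forall>s>0. (\<lambda>N. real (card {(m, n). m \<in> {1..N} \<and> n \<in> {1..N} \<and> m \<noteq> n \<and>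
                                     dist_int (y m - y n) < s / real N}) / real N)
            \<longlonglongrightarrow> 2 * s)"

end

theory Submission
  imports Defs
begin

text \<open>Let \<open>F\<^sub>N\<close> be the sum of the densities on the circle of \<open>x\<^sub>n + z\<^sub>n\<close>, \<open>n \<le> N\<close>. The hypotheses give
  \<open>M\<^sub>N = o(N g(N))\<close>, and cutting \<open>{1..N}\<close> into blocks on which \<open>M\<^sub>n / g(n)\<close> is nearly constant yields
  \<open>F\<^sub>N(t) = N + o(N)\<close> uniformly in \<open>t\<close>. So, given \<open>y\<^sub>m\<close>, the expected number of \<open>n \<le> N\<close> with \<open>y\<^sub>n\<close> within
  \<open>s / N\<close> of \<open>y\<^sub>m\<close> tends to \<open>2 s\<close> (the term \<open>n = m\<close> is negligible since \<open>N g(N) \<rightarrow> \<infinity>\<close>), and the pair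
  count has mean \<open>2 s N + o(N)\<close>. Pairs without a common index are independent, which bounds the
  variance by \<open>O(N)\<close>. Second moments thus give almost sure convergence along the squares, and
  monotonicity of the pair count in \<open>N\<close> and in the distance fills the gaps.\<close>

section \<open>Discrepancy and the smeared density\<close>

text \<open>A real supremum dominates the members of its set only if the set is bounded above; here
  1 is a bound, since the proportion and the length both lie in [0, 1].\<close>

lemma discrepancy_upper:
  assumes "0 \<le> a" "a \<le> b" "b \<le> 1"
  shows "\<bar>real (card {n \<in> {1..N}. frac (x n) \<in> {a..b}}) / real N - (b - a)\<bar> \<le> discrepancy x N"
  unfolding discrepancy_def
proof (rule cSup_upper)
  show "bdd_above {\<bar>real (card {n \<in> {1..N}. frac (x n) \<in> {a..b}}) / real N - (b - a)\<bar>
                          | a b. 0 \<le> a \<and> a \<le> b \<and> b \<le> 1}"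
  proof (rule bdd_aboveI[of _ 1], clarify)
    fix a b :: real
    assume ab: "0 \<le> a" "a \<le> b" "b \<le> 1"
    have "card {n \<in> {1..N}. frac (x n) \<in> {a..b}} \<le> card {1..N}"
      by (rule card_mono) auto
    then have "real (card {n \<in> {1..N}. frac (x n) \<in> {a..b}}) / real N \<le> 1"
      by (cases "N = 0") (simp_all del: atLeastAtMost_iff)
    moreover have "0 \<le> real (card {n \<in> {1..N}. frac (x n) \<in> {a..b}}) / real N"
      by simp
    ultimately show "\<bar>real (card {n \<in> {1..N}. frac (x n) \<in> {a..b}}) / real N - (b - a)\<bar> \<le> 1"
      using ab by linarith
  qed
qed (use assms in blast)

lemma card_discrepancy_bound:
  assumes "0 \<le> a" "a \<le> b" "b \<le> 1"
  shows "\<bar>(\<Sum>n\<in>{1..N}. of_bool (frac (x n) \<in> {a..b})) - real N * (b - a)\<bar> \<le> real N * discrepancy x N"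
proof (cases "N = 0")
  case False
  have "(\<Sum>n\<in>{1..N}. of_bool (frac (x n) \<in> {a..b})) = real (card {n \<in> {1..N}. frac (x n) \<in> {a..b}})"
    by (simp add: of_bool_def sum.If_cases Int_def del: atLeastAtMost_iff)
  with discrepancy_upper[OF assms, of N x] False show ?thesis
    by (simp add: field_simps abs_le_iff del: atLeastAtMost_iff)
qed simp

lemma discrepancy_nonneg: "0 \<le> discrepancy x N"
  using discrepancy_upper[of 0 0 N x] by linarith

text \<open>For \<open>c \<ge> 0\<close> this is the number of integers \<open>k\<close> with \<open>\<bar>w + k\<bar> \<le> c\<close>.\<close>

definition cover :: "real \<Rightarrow> real \<Rightarrow> real" where
  "cover c w = of_int (\<lfloor>c - w\<rfloor> + \<lfloor>c + w\<rfloor> + 1)"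

text \<open>The integers counted form the interval from \<open>\<lceil>- c - w\<rceil>\<close> to
  \<open>\<lfloor>c - w\<rfloor>\<close>. Allowing any finite superset \<open>K\<close> lets one
  index set serve all \<open>w\<close> in a bounded range.\<close>

lemma sum_of_bool_eq_cover:
  assumes "0 \<le> c" "finite K" "{\<lceil>- c - w\<rceil>..\<lfloor>c - w\<rfloor>} \<subseteq> K"
  shows "(\<Sum>k\<in>K. of_bool (\<bar>w + of_int k\<bar> \<le> c)) = cover c w"
proof -
  have iff: "\<bar>w + of_int k\<bar> \<le> c \<longleftrightarrow> k \<in> {\<lceil>- c - w\<rceil>..\<lfloor>c - w\<rfloor>}" for k :: int
    by (auto simp: ceiling_le_iff le_floor_iff abs_le_iff)
  have "(\<Sum>k\<in>K. of_bool (\<bar>w + of_int k\<bar> \<le> c)) = real (card (K \<inter> {\<lceil>- c - w\<rceil>..\<lfloor>c - w\<rfloor>}))"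
    using assms(2) unfolding iff by (simp add: of_bool_def sum.If_cases del: atLeastAtMost_iff)
  also have "K \<inter> {\<lceil>- c - w\<rceil>..\<lfloor>c - w\<rfloor>} = {\<lceil>- c - w\<rceil>..\<lfloor>c - w\<rfloor>}"
    using assms(3) by blast
  also have "real (card {\<lceil>- c - w\<rceil>..\<lfloor>c - w\<rfloor>}) = of_int (\<lfloor>c - w\<rfloor> - \<lceil>- c - w\<rceil> + 1)"
  proof -
    \<comment> \<open>For \<open>c \<ge> 0\<close> the integer interval may be empty, but its formal
      length is never negative, so it equals the cardinality.\<close>
    have "of_int (\<lfloor>c - w\<rfloor> - \<lceil>- c - w\<rceil> + 1) > (-1 :: real)"
      using assms(1) by linarith
    then have "\<lfloor>c - w\<rfloor> - \<lceil>- c - w\<rceil> + 1 \<ge> 0"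
      by linarith
    then show ?thesis
      by simp
  qed
  also have "\<dots> = cover c w"
    by (simp add: cover_def ceiling_def add.commute)
  finally show ?thesis .
qed

lemma cover_nonneg:
  assumes "0 \<le> c"
  shows "0 \<le> cover c w"
proof -
  have "of_int (\<lfloor>c - w\<rfloor> + \<lfloor>c + w\<rfloor> + 1) > (-1 :: real)"
    using assms by linarith
  then have "0 \<le> \<lfloor>c - w\<rfloor> + \<lfloor>c + w\<rfloor> + 1"
    by linarith
  then show ?thesis
    unfolding cover_def of_int_0_le_iff .
qed

lemma cover_upper: "cover c w \<le> 2 * c + 1"
  unfolding cover_def by linarith

lemma cover_mono: "c \<le> d \<Longrightarrow> cover c w \<le> cover d w"
  unfolding cover_def of_int_le_iff by (intro add_mono floor_mono) auto

lemma cover_measurable [measurable]: "(\<lambda>w. cover c (f w)) \<in> borel_measurable M"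
  if [measurable]: "f \<in> borel_measurable M"
  unfolding cover_def by measurable

text \<open>Adding \<open>y\<close> to \<open>c - t\<close> and subtracting it from
  \<open>c + t\<close> shifts the two floors by opposite amounts \<open>\<lfloor>y\<rfloor>\<close>,
  which cancel; only the two carries remain. Each carry places \<open>frac y\<close> in an interval
  ending at 1 or starting at 0, to which the discrepancy applies.\<close>

lemma cover_eq_of_bool:
  "cover c (t - y) = of_int \<lfloor>c - t\<rfloor> + of_int \<lfloor>c + t\<rfloor>
     + of_bool (frac y \<in> {1 - frac (c - t)..1}) + of_bool (frac y \<in> {0..frac (c + t)})"
proof -
  define p q where "p = \<lfloor>c - t\<rfloor>" and "q = \<lfloor>c + t\<rfloor>"
  define k where "k = \<lfloor>y\<rfloor>"
  have p: "of_int p \<le> c - t" "c - t < of_int p + 1" and q: "of_int q \<le> c + t" "c + t < of_int q + 1"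
    and k: "of_int k \<le> y" "y < of_int k + 1"
    unfolding p_def q_def k_def by linarith+
  have fr: "frac (c - t) = c - t - p" "frac (c + t) = c + t - q" "frac y = y - k"
    by (simp_all add: frac_def p_def q_def k_def)
  have "\<lfloor>c - (t - y)\<rfloor> = p + k + of_bool (frac y \<in> {1 - frac (c - t)..1})"
    unfolding fr using p k by (intro floor_unique) (auto simp: of_bool_def)
  moreover have "\<lfloor>c + (t - y)\<rfloor> = q - k - 1 + of_bool (frac y \<in> {0..frac (c + t)})"
    unfolding fr using q k by (intro floor_unique) (auto simp: of_bool_def)
  ultimately show ?thesis
    unfolding cover_def p_def [symmetric] q_def [symmetric] by simp
qed

text \<open>The intervals in \<open>cover_eq_of_bool\<close> have lengths
  \<open>frac (c - t)\<close> and \<open>frac (c + t)\<close>, which together with the floors add up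
  to exactly \<open>2 * c\<close>; each interval costs one discrepancy error. Arcs that wrap round
  the circle are included.\<close>

lemma sum_cover_discrepancy:
  "\<bar>(\<Sum>n\<in>{1..N}. cover c (t - x n)) - 2 * c * real N\<bar> \<le> 2 * (real N * discrepancy x N)"
proof -
  define A B where "A = (\<Sum>n\<in>{1..N}. of_bool (frac (x n) \<in> {1 - frac (c - t)..1}) :: real)"
    and "B = (\<Sum>n\<in>{1..N}. of_bool (frac (x n) \<in> {0..frac (c + t)}) :: real)"
  have "\<bar>A - real N * (1 - (1 - frac (c - t)))\<bar> \<le> real N * discrepancy x N"
    unfolding A_def using frac_lt_1[of "c - t"] by (intro card_discrepancy_bound) auto
  moreover have "\<bar>B - real N * (frac (c + t) - 0)\<bar> \<le> real N * discrepancy x N"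
    unfolding B_def using frac_lt_1[of "c + t"] by (intro card_discrepancy_bound) (auto intro: less_imp_le)
  moreover have "(\<Sum>n\<in>{1..N}. cover c (t - x n))
      = real N * (of_int \<lfloor>c - t\<rfloor> + of_int \<lfloor>c + t\<rfloor>) + A + B"
    unfolding cover_eq_of_bool A_def B_def sum.distrib by (simp add: algebra_simps)
  moreover have "2 * c * real N = real N * (of_int \<lfloor>c - t\<rfloor> + of_int \<lfloor>c + t\<rfloor>)
      + real N * frac (c - t) + real N * frac (c + t)"
    by (simp add: frac_def algebra_simps)
  ultimately show ?thesis
    unfolding abs_le_iff by (simp add: algebra_simps)
qed

section \<open>The running maximum of \<open>n * discrepancy x n\<close>\<close>

lemma max_nD_ge: "1 \<le> n \<Longrightarrow> n \<le> N \<Longrightarrow> real n * discrepancy x n \<le> max_nD x N"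
  unfolding max_nD_def by (intro Max_ge) auto

lemma max_nD_attained: "1 \<le> N \<Longrightarrow> \<exists>n\<in>{1..N}. max_nD x N = real n * discrepancy x n"
  using Max_in[of "(\<lambda>n. real n * discrepancy x n) ` {1..N}"] unfolding max_nD_def by fastforce

lemma max_nD_mono: "1 \<le> m \<Longrightarrow> m \<le> N \<Longrightarrow> max_nD x m \<le> max_nD x N"
  unfolding max_nD_def by (intro Max_mono) auto

lemma max_nD_nonneg: "1 \<le> N \<Longrightarrow> 0 \<le> max_nD x N"
  using max_nD_ge[of N N x] discrepancy_nonneg[of x N]
  by (meson mult_nonneg_nonneg of_nat_0_le_iff order_trans order_refl)

text \<open>A block is the difference of two initial segments, each with error at most
  \<open>2 * max_nD x N\<close>.\<close>

lemma sum_cover_block: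
  assumes "b < N"
  shows "\<bar>(\<Sum>n\<in>{b<..N}. cover c (t - x n)) - 2 * c * real (N - b)\<bar> \<le> 4 * max_nD x N"
proof -
  have split: "{1..N} = {1..b} \<union> {b<..N}" "{1..b} \<inter> {b<..N} = {}"
    using assms by auto
  have "(\<Sum>n\<in>{1..N}. cover c (t - x n)) = (\<Sum>n\<in>{1..b}. cover c (t - x n)) + (\<Sum>n\<in>{b<..N}. cover c (t - x n))"
    unfolding split(1) using split(2) by (intro sum.union_disjoint) auto
  moreover have "real b * discrepancy x b \<le> max_nD x N"
    using assms max_nD_ge[of b N x] max_nD_nonneg[of N x] by (cases "b = 0") auto
  moreover have "real N * discrepancy x N \<le> max_nD x N"
    using assms by (intro max_nD_ge) auto
  moreover have "2 * c * real (N - b) = 2 * c * real N - 2 * c * real b"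
    using assms by (simp add: of_nat_diff algebra_simps)
  ultimately show ?thesis
    using sum_cover_discrepancy[where N = N and c = c and t = t and x = x] sum_cover_discrepancy[where N = b and c = c and t = t and x = x]
    by linarith
qed

text \<open>The density on the circle of \<open>x n + z n\<close> when \<open>z n\<close> is uniform on \<open>[- g n, g n]\<close>.\<close>

definition smeared_density :: "(nat \<Rightarrow> real) \<Rightarrow> (real \<Rightarrow> real) \<Rightarrow> nat \<Rightarrow> real \<Rightarrow> real" where
  "smeared_density x g n t = cover (g (real n)) (t - x n) / (2 * g (real n))"

text \<open>The potential \<open>max_nD x N / g N\<close> is increasing. On an index block over which it grows by a
  factor at most \<open>1 + \<delta>\<close> the function \<open>g\<close> is constant up to that factor, and the discrepancy error
  of the block is absorbed by the increase of the potential.\<close>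

lemma sum_smeared_density_error:
  assumes g_pos: "\<forall>t>0. g t > 0"
    and g_decr: "\<forall>s t. 0 < s \<longrightarrow> s \<le> t \<longrightarrow> g t \<le> g s"
    and \<delta>: "0 < \<delta>"
  shows "\<bar>(\<Sum>n\<in>{1..N}. smeared_density x g n t) - real N\<bar>
    \<le> \<delta> * real N + 2 * ((1 + \<delta>) / \<delta>) * (if N = 0 then 0 else max_nD x N / g (real N))"
proof -
  \<comment> \<open>\<open>max_nD x 0\<close> is a maximum over the empty set and \<open>g 0\<close>
    is unconstrained, so the potential is set to 0 there. This makes 0 an admissible left end of a
    block.\<close>
  define h where "h N = (if N = 0 then 0 else max_nD x N / g (real N))" for N :: nat
  define f where "f = (\<lambda>n. smeared_density x g n t)"
  have gp: "0 < g (real n)" if "n \<ge> 1" for n :: nat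
    using g_pos that by simp
  have gd: "g (real n) \<le> g (real m)" if "1 \<le> m" "m \<le> n" for m n :: nat
    using g_decr that by simp
  have h_nonneg: "0 \<le> h N" for N
    using max_nD_nonneg[of N x] gp[of N] by (auto simp: h_def intro!: divide_nonneg_nonneg less_imp_le[OF gp])
  have "\<bar>(\<Sum>n\<in>{1..N}. f n) - real N\<bar> \<le> \<delta> * real N + 2 * ((1 + \<delta>) / \<delta>) * h N"
  proof (induction N rule: less_induct)
    case (less N)
    show ?case
    proof (cases "N = 0")
      case False
      then have N: "1 \<le> N" by simp
      \<comment> \<open>The last member \<open>b\<close> of \<open>S\<close> is the left end of the
        final block \<open>{b<..N}\<close>: beyond it the potential stays within a factor
        \<open>1 + \<delta>\<close> of \<open>h N\<close>.\<close>
      define S where "S = {b. b < N \<and> h b * (1 + \<delta>) \<le> h N}"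
      define b where "b = Max S"
      have "finite S" unfolding S_def by simp
      moreover have "0 \<in> S" using N h_nonneg[of N] by (simp add: S_def h_def)
      ultimately have "b \<in> S" and bmax: "\<And>j. j \<in> S \<Longrightarrow> j \<le> b"
        unfolding b_def by (auto intro!: Max_in)
      then have b: "b < N" "h b * (1 + \<delta>) \<le> h N"
        by (auto simp: S_def)
      define c where "c = g (real N)"
      have c: "0 < c" using gp N by (simp add: c_def)
      have gn: "c \<le> g (real n)" "g (real n) \<le> (1 + \<delta>) * c" if n: "b < n" "n \<le> N" for n
      proof -
        have n1: "1 \<le> n" using n by simp
        show "c \<le> g (real n)" using gd[OF n1 n(2)] by (simp add: c_def)
        show "g (real n) \<le> (1 + \<delta>) * c"
        proof (cases "n = N")
          case True
          with c \<delta> show ?thesis by (simp add: c_def algebra_simps)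
        next
          case False
          \<comment> \<open>From \<open>n\<close> to \<open>N\<close> the potential grows by a
            factor below \<open>1 + \<delta>\<close> while \<open>max_nD\<close> does not decrease,
            so \<open>g\<close> drops by less than that factor. The strict inequality also forces
            \<open>max_nD x N\<close> to be nonzero, which permits the cancellation.\<close>
          then have "n \<notin> S" using bmax[of n] n by auto
          then have "h N < h n * (1 + \<delta>)" using False n by (simp add: S_def)
          then have "max_nD x N / c < max_nD x n / g (real n) * (1 + \<delta>)"
            using n1 N by (simp add: h_def c_def)
          also have "\<dots> \<le> max_nD x N / g (real n) * (1 + \<delta>)"
            using max_nD_mono[OF n1 n(2), of x] \<delta> gp[OF n1]
            by (intro mult_right_mono divide_right_mono) auto
          finally have *: "max_nD x N * g (real n) < max_nD x N * ((1 + \<delta>) * c)"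
            using c gp[OF n1] by (simp add: field_simps)
          with max_nD_nonneg[OF N, of x] show ?thesis
            by (simp add: mult_less_cancel_left)
        qed
      qed
      have sum_split: "(\<Sum>n\<in>{1..N}. f n) = (\<Sum>n\<in>{1..b}. f n) + (\<Sum>n\<in>{b<..N}. f n)"
      proof -
        have "{1..N} = {1..b} \<union> {b<..N}" using b by auto
        then show ?thesis by (simp add: sum.union_disjoint ivl_disj_int)
      qed
      define L where "L = real (N - b)"
      have L: "0 \<le> L" "real N = real b + L" using b by (auto simp: L_def)
      have hN: "h N = max_nD x N / c" using N by (simp add: h_def c_def)
      \<comment> \<open>The radii of the block lie between \<open>c\<close> and
        \<open>(1 + \<delta>) * c\<close>. The upper bound puts the larger one into the numerator
        and the smaller one into the denominator; the lower bound does the reverse.\<close>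
      have "(\<Sum>n\<in>{b<..N}. f n) \<le> (\<Sum>n\<in>{b<..N}. cover ((1 + \<delta>) * c) (t - x n)) / (2 * c)"
        unfolding sum_divide_distrib f_def smeared_density_def
        using gn c by (intro sum_mono frac_le cover_mono cover_nonneg) (auto simp: \<delta> less_imp_le)
      also have "\<dots> \<le> (2 * ((1 + \<delta>) * c) * L + 4 * max_nD x N) / (2 * c)"
        using sum_cover_block[OF b(1), of "(1 + \<delta>) * c" t x] c unfolding L_def[symmetric]
        by (intro divide_right_mono) auto
      also have "\<dots> = (1 + \<delta>) * L + 2 * h N"
        using c by (simp add: hN field_simps)
      finally have up: "(\<Sum>n\<in>{b<..N}. f n) \<le> (1 + \<delta>) * L + 2 * h N" .
      have "(1 - \<delta>) * L - 2 * h N \<le> L / (1 + \<delta>) - 2 * h N / (1 + \<delta>)"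
      proof -
        have "(1 - \<delta>) * (1 + \<delta>) \<le> 1" by (simp add: algebra_simps)
        then have "(1 - \<delta>) \<le> 1 / (1 + \<delta>)" using \<delta> by (simp add: field_simps)
        then have "(1 - \<delta>) * L \<le> L / (1 + \<delta>)" using mult_right_mono[OF _ L(1)] by fastforce
        moreover have "2 * h N / (1 + \<delta>) \<le> 2 * h N"
          using h_nonneg[of N] \<delta> by (simp add: field_simps)
        ultimately show ?thesis by linarith
      qed
      also have "\<dots> = (2 * c * L - 4 * max_nD x N) / (2 * ((1 + \<delta>) * c))"
        using c \<delta> by (simp add: hN divide_simps)
      also have "\<dots> \<le> (\<Sum>n\<in>{b<..N}. cover c (t - x n)) / (2 * ((1 + \<delta>) * c))"
        using sum_cover_block[OF b(1), of c t x] c \<delta> unfolding L_def[symmetric]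
        by (intro divide_right_mono) auto
      also have "\<dots> \<le> (\<Sum>n\<in>{b<..N}. f n)"
        unfolding sum_divide_distrib f_def smeared_density_def
        using gn c by (intro sum_mono frac_le cover_mono cover_nonneg) (auto intro: less_le_trans less_imp_le order_trans[of 0 c])
      finally have low: "(1 - \<delta>) * L - 2 * h N \<le> (\<Sum>n\<in>{b<..N}. f n)" .
      \<comment> \<open>Membership of \<open>b\<close> in \<open>S\<close> bounds \<open>h N\<close>
        by a multiple of the increase \<open>h N - h b\<close>. The block error
        \<open>2 * h N\<close> is thus paid by that increase, which explains the coefficient
        \<open>2 * ((1 + \<delta>) / \<delta>)\<close>.\<close>
      have "h N \<le> (1 + \<delta>) / \<delta> * (h N - h b)"
        using b(2) \<delta> by (simp add: field_simps)
      then have hb: "2 * h N \<le> 2 * ((1 + \<delta>) / \<delta>) * h N - 2 * ((1 + \<delta>) / \<delta>) * h b"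
        unfolding right_diff_distrib by linarith
      have "\<bar>(\<Sum>n\<in>{1..b}. f n) - real b\<bar> \<le> \<delta> * real b + 2 * ((1 + \<delta>) / \<delta>) * h b"
        using less.IH[OF b(1)] .
      with up low hb show ?thesis
        unfolding sum_split L(2) abs_le_iff by (simp only: ring_distribs) linarith
    qed (simp add: h_def)
  qed
  then show ?thesis
    by (simp add: h_def f_def)
qed

text \<open>Let \<open>D\<close> be the maximum, attained at \<open>n \<le> N\<close>, so that \<open>max_nD x\<close> is constant on \<open>[n, N]\<close>. From
  the last \<open>m\<close> in \<open>[n, N]\<close> with \<open>2 * K * D \<le> m * g m\<close>, a step of length \<open>D / g m\<close> hardly changes \<open>g\<close>
  by \<open>lim3\<close>, so it restores this inequality; hence that step must lead beyond \<open>N\<close>.\<close>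

lemma max_nD_small:
  fixes x :: "nat \<Rightarrow> real" and g :: "real \<Rightarrow> real" and K :: real
  assumes g_pos: "\<forall>t>0. g t > 0"
    and g_decr: "\<forall>s t. 0 < s \<longrightarrow> s \<le> t \<longrightarrow> g t \<le> g s"
    and lim1: "filterlim (\<lambda>N. g (real N) / discrepancy x N) at_top sequentially"
    and lim2: "filterlim (\<lambda>N. real N * g (real N)) at_top sequentially"
    and lim3: "(\<lambda>N. g (real N * (1 + max_nD x N / (real N * g (real N)))) / g (real N))
                 \<longlonglongrightarrow> 1"
    and K: "0 < K"
  shows "eventually (\<lambda>N. K * max_nD x N \<le> real N * g (real N)) sequentially"
proof (cases "\<exists>B. \<forall>N\<ge>1. max_nD x N \<le> B")
  case True
  then obtain B where B: "\<And>N. N \<ge> 1 \<Longrightarrow> max_nD x N \<le> B" by blast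
  have "eventually (\<lambda>N. K * B \<le> real N * g (real N)) sequentially"
    using lim2 by (simp add: filterlim_at_top)
  then show ?thesis
    using eventually_ge_at_top[of 1]
  proof eventually_elim
    case (elim N)
    have "K * max_nD x N \<le> K * B" using B[OF elim(2)] K by simp
    with elim(1) show ?case by linarith
  qed
next
  case False
  \<comment> \<open>In the unbounded case \<open>D\<close> exceeds \<open>2 * g 1\<close> from
    \<open>N'\<close> on. A step of length \<open>D / g m\<close> is then at least 2 and survives
    rounding down to an integer.\<close>
  then obtain N' where N': "1 \<le> N'" "2 * g 1 < max_nD x N'"
    by (meson not_le)
  \<comment> \<open>\<open>\<eta> \<le> 1 / (4 * K + 1)\<close> lets a gain of \<open>D / 2\<close>
    offset the factor \<open>1 - \<eta>\<close>; \<open>\<eta> \<le> 1 / 2\<close> leaves at least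
    \<open>K\<close> of \<open>2 * K\<close> in the final estimate.\<close>
  define \<eta> where "\<eta> = 1 / (4 * K + 2)"
  have \<eta>: "0 < \<eta>" "\<eta> \<le> 1 / 2" "(1 - \<eta>) * (2 * K + 1 / 2) \<ge> 2 * K" "(1 - \<eta>) * (2 * K) \<ge> K"
  proof -
    show "0 < \<eta>" "\<eta> \<le> 1 / 2" using K by (auto simp: \<eta>_def field_simps)
    show "(1 - \<eta>) * (2 * K + 1 / 2) \<ge> 2 * K" using K by (simp add: \<eta>_def field_simps)
    have "(1 - \<eta>) * (2 * K) \<ge> 1 / 2 * (2 * K)" using \<open>\<eta> \<le> 1 / 2\<close> K by (intro mult_right_mono) auto
    then show "(1 - \<eta>) * (2 * K) \<ge> K" by simp
  qed
  have "eventually (\<lambda>n. 1 - \<eta> < g (real n * (1 + max_nD x n / (real n * g (real n)))) / g (real n)) sequentially"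
    using lim3 \<eta>(1) by (intro order_tendstoD(1)) auto
  moreover have "eventually (\<lambda>n. 2 * K \<le> g (real n) / discrepancy x n) sequentially"
    using lim1 by (simp add: filterlim_at_top)
  moreover have "eventually (\<lambda>n. N' \<le> n \<and> 1 \<le> n) sequentially"
    using eventually_ge_at_top[of "max N' 1"] by eventually_elim auto
  ultimately have "eventually (\<lambda>n. (1 - \<eta>) * g (real n) \<le> g (real n + max_nD x n / g (real n))
      \<and> 2 * K * discrepancy x n \<le> g (real n) \<and> N' \<le> n \<and> 1 \<le> n) sequentially"
  proof eventually_elim
    case (elim n)
    have gn: "0 < g (real n)" using g_pos elim by auto
    have "real n * (1 + max_nD x n / (real n * g (real n))) = real n + max_nD x n / g (real n)"
      using elim gn by (simp add: field_simps)
    with elim(1) have "(1 - \<eta>) * g (real n) \<le> g (real n + max_nD x n / g (real n))"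
      using gn by (simp add: field_simps)
    moreover have "2 * K * discrepancy x n \<le> g (real n)"
    proof (cases "discrepancy x n = 0")
      case False
      with discrepancy_nonneg[of x n] have "0 < discrepancy x n" by simp
      with elim(2) show ?thesis by (simp add: field_simps)
    qed (use gn in simp)
    ultimately show ?case using elim(3) by simp
  qed
  then obtain N0 where N0: "\<And>n. n \<ge> N0 \<Longrightarrow> (1 - \<eta>) * g (real n) \<le> g (real n + max_nD x n / g (real n))"
      "\<And>n. n \<ge> N0 \<Longrightarrow> 2 * K * discrepancy x n \<le> g (real n)"
      "\<And>n. n \<ge> N0 \<Longrightarrow> N' \<le> n" "\<And>n. n \<ge> N0 \<Longrightarrow> 1 \<le> n"
    unfolding eventually_sequentially by blast
  have "eventually (\<lambda>N. K * max_nD x N0 \<le> real N * g (real N)) sequentially"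
    using lim2 by (simp add: filterlim_at_top)
  then show ?thesis
    using eventually_ge_at_top[of N0]
  proof eventually_elim
    case (elim N)
    have N1: "1 \<le> N" using N0(4)[OF elim(2)] .
    obtain n where n: "1 \<le> n" "n \<le> N" "max_nD x N = real n * discrepancy x n"
      using max_nD_attained[OF N1, of x] by auto
    show ?case
    proof (cases "n < N0")
      case True
      \<comment> \<open>A maximum attained before \<open>N0\<close> is dominated by the fixed number
        \<open>max_nD x N0\<close>, which \<open>lim2\<close> handles.\<close>
      then have "max_nD x N \<le> max_nD x N0" using n max_nD_ge[of n N0 x] by simp
      then have "K * max_nD x N \<le> K * max_nD x N0" using K by simp
      with elim(1) show ?thesis by linarith
    next
      case False
      define D where "D = max_nD x N"
      have D_nonneg: "0 \<le> D" using max_nD_nonneg[OF N1] by (simp add: D_def)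
      have const: "max_nD x m = D" if "n \<le> m" "m \<le> N" for m
        using max_nD_ge[of n m x] max_nD_mono[of m N x] n that unfolding D_def by simp
      have D_large: "2 * g 1 < D"
        using N'(2) max_nD_mono[of N' N x] N0(3)[OF elim(2)] N'(1) unfolding D_def by simp
      define S where "S = {m. n \<le> m \<and> m \<le> N \<and> 2 * K * D \<le> real m * g (real m)}"
      have "n \<in> S"
      proof -
        \<comment> \<open>Since \<open>D = n * discrepancy x n\<close>, the bound obtained from
          \<open>lim1\<close> is the inequality defining \<open>S\<close> at the starting
          index.\<close>
        have "real n * (2 * K * discrepancy x n) \<le> real n * g (real n)"
          using N0(2)[of n] False by (intro mult_left_mono) auto
        then show ?thesis using n by (simp add: S_def D_def mult_ac)
      qed
      moreover have finS: "finite S" by (rule finite_subset[of _ "{..N}"]) (auto simp: S_def)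
      ultimately have mS: "Max S \<in> S" by (intro Max_in) auto
      define m where "m = Max S"
      have m: "n \<le> m" "m \<le> N" "2 * K * D \<le> real m * g (real m)"
        using mS by (auto simp: S_def m_def)
      have m1: "1 \<le> m" "N0 \<le> m" using m n False by auto
      have gm: "0 < g (real m)" "g (real m) \<le> g 1" using g_pos g_decr m1 by auto
      define m' where "m' = nat \<lfloor>real m + D / g (real m)\<rfloor>"
      have step: "2 \<le> D / g (real m)"
        using D_large gm by (simp add: field_simps)
      have m': "real m' \<le> real m + D / g (real m)" "real m + D / g (real m) - 1 \<le> real m'" "m < m'"
      proof -
        have "real m' = of_int \<lfloor>real m + D / g (real m)\<rfloor>"
          unfolding m'_def using step by simp
        then show "real m' \<le> real m + D / g (real m)" "real m + D / g (real m) - 1 \<le> real m'"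
          by linarith+
        with step show "m < m'" by linarith
      qed
      have slow: "(1 - \<eta>) * g (real m) \<le> g (real k)" if "real k \<le> real m + D / g (real m)" "m \<le> k" for k
      proof -
        have "(1 - \<eta>) * g (real m) \<le> g (real m + D / g (real m))"
          using N0(1)[OF m1(2)] const[OF m(1,2)] by simp
        also have "\<dots> \<le> g (real k)" using g_decr that m1 by auto
        finally show ?thesis .
      qed
      have \<eta>1: "0 \<le> 1 - \<eta>" using \<eta> by simp
      show ?thesis
      proof (cases "N \<le> m'")
        case True
        \<comment> \<open>The step reaches \<open>N\<close>, so \<open>g N\<close> is at least
          \<open>(1 - \<eta>) * g m\<close> and the inequality at \<open>m\<close> passes to
          \<open>N\<close> with half the constant.\<close>
        have "K * D \<le> (1 - \<eta>) * (2 * K) * D"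
          using \<eta>(4) D_nonneg by (intro mult_right_mono) auto
        also have "\<dots> = (1 - \<eta>) * (2 * K * D)" by simp
        also have "\<dots> \<le> (1 - \<eta>) * (real m * g (real m))"
          using m(3) \<eta>1 by (intro mult_left_mono) auto
        also have "\<dots> = real m * ((1 - \<eta>) * g (real m))" by simp
        also have "\<dots> \<le> real N * g (real N)"
          using slow[of N] True m' m \<eta>1 gm by (intro mult_mono) auto
        finally show ?thesis by (simp add: D_def)
      next
        case False
        \<comment> \<open>The step stops short of \<open>N\<close>. Even after rounding it adds
          \<open>D - g m \<ge> D / 2\<close> to \<open>m * g m\<close> before the factor
          \<open>1 - \<eta>\<close>, so \<open>m'\<close> belongs to \<open>S\<close>, against the
          maximality of \<open>m\<close>.\<close>
        have "2 * K * D \<le> (1 - \<eta>) * (2 * K + 1 / 2) * D"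
          using \<eta>(3) D_nonneg by (intro mult_right_mono) auto
        also have "\<dots> = (1 - \<eta>) * (2 * K * D + D / 2)" by (simp add: algebra_simps)
        also have "\<dots> \<le> (1 - \<eta>) * (real m * g (real m) + D - g (real m))"
          using m(3) \<eta>1 D_large gm by (intro mult_left_mono) auto
        also have "\<dots> = (real m + D / g (real m) - 1) * ((1 - \<eta>) * g (real m))"
          using gm by (simp add: field_simps)
        also have "\<dots> \<le> real m' * g (real m')"
          using slow[of m'] m' m \<eta>1 gm by (intro mult_mono) auto
        finally have "m' \<in> S" using False m' m by (simp add: S_def)
        then have "m' \<le> m" using finS by (simp add: m_def)
        with m' show ?thesis by simp
      qed
    qed
  qed
qed

lemma sum_smeared_density_uniform:
  fixes x :: "nat \<Rightarrow> real" and g :: "real \<Rightarrow> real" and \<epsilon> :: real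
  assumes g_pos: "\<forall>t>0. g t > 0"
    and g_decr: "\<forall>s t. 0 < s \<longrightarrow> s \<le> t \<longrightarrow> g t \<le> g s"
    and small: "\<And>K. 0 < K \<Longrightarrow> eventually (\<lambda>N. K * max_nD x N \<le> real N * g (real N)) sequentially"
    and \<epsilon>: "0 < \<epsilon>"
  shows "eventually (\<lambda>N. \<forall>t. \<bar>(\<Sum>n\<in>{1..N}. smeared_density x g n t) - real N\<bar> \<le> \<epsilon> * real N) sequentially"
proof -
  \<comment> \<open>\<open>C\<close> is the coefficient of the potential in the error bound for
    \<open>\<delta> = \<epsilon> / 2\<close>; taking \<open>K = 2 * C / \<epsilon>\<close> in
    \<open>small\<close> bounds the potential term by the other half of the error.\<close>
  define C where "C = 2 * ((1 + \<epsilon> / 2) / (\<epsilon> / 2))"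
  have C: "0 < C" using \<epsilon> by (simp add: C_def field_simps)
  have "eventually (\<lambda>N. 2 * C / \<epsilon> * max_nD x N \<le> real N * g (real N)) sequentially"
    using C \<epsilon> by (intro small) simp
  then show ?thesis
    using eventually_ge_at_top[of 1]
  proof eventually_elim
    case (elim N)
    have "0 < g (real N)" using g_pos elim by simp
    then have "C * (max_nD x N / g (real N)) = \<epsilon> / 2 * ((2 * C / \<epsilon> * max_nD x N) / g (real N))"
      using \<epsilon> by simp
    also have "\<dots> \<le> \<epsilon> / 2 * (real N * g (real N) / g (real N))"
      using elim(1) \<epsilon> \<open>0 < g (real N)\<close> by (intro mult_left_mono divide_right_mono) auto
    also have "\<dots> = \<epsilon> / 2 * real N"
      using \<open>0 < g (real N)\<close> by simp
    finally have *: "C * (max_nD x N / g (real N)) \<le> \<epsilon> / 2 * real N" .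
    show ?case
    proof
      fix t
      have "\<bar>(\<Sum>n\<in>{1..N}. smeared_density x g n t) - real N\<bar>
          \<le> \<epsilon> / 2 * real N + C * (if N = 0 then 0 else max_nD x N / g (real N))"
        unfolding C_def using \<epsilon> by (intro sum_smeared_density_error[OF g_pos g_decr]) simp
      also have "\<dots> \<le> \<epsilon> / 2 * real N + \<epsilon> / 2 * real N"
        using elim(2) by (intro add_left_mono order_trans[OF _ *]) simp
      finally show "\<bar>(\<Sum>n\<in>{1..N}. smeared_density x g n t) - real N\<bar> \<le> \<epsilon> * real N"
        by simp
    qed
  qed
qed

section \<open>Distance to the nearest integer under a uniform law\<close>

text \<open>\<open>round\<close> breaks ties upwards and does not commute with negation at
  half-integers. Minimality of the rounding distance gives one inequality for all \<open>y\<close>;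
  substituting \<open>- y\<close> gives the other.\<close>

lemma dist_int_minus [simp]: "dist_int (- y) = dist_int y"
proof -
  have "dist_int (- y) \<le> dist_int y" for y
    using round_diff_minimal[of "- y" "- round y"] by (simp add: dist_int_def abs_minus_commute)
  from this[of y] this[of "- y"] show ?thesis
    by simp
qed

lemma dist_int_diff_commute: "dist_int (a - b) = dist_int (b - a)"
  using dist_int_minus[of "a - b"] by simp

lemma dist_int_measurable [measurable]: "(\<lambda>w. dist_int (f w)) \<in> borel_measurable M"
  if [measurable]: "f \<in> borel_measurable M"
  unfolding dist_int_def round_def by measurable

text \<open>A distance strictly below 1/2 determines the integer, so only \<open>k = round y\<close>
  can contribute.\<close>

lemma indicator_dist_int_eq_sum:
  assumes "r \<le> 1 / 2" "finite K" "round y \<in> K"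
  shows "(of_bool (dist_int y < r) :: real) = (\<Sum>k\<in>K. of_bool (\<bar>y - of_int k\<bar> < r))"
proof -
  have "\<bar>y - of_int k\<bar> < r \<longleftrightarrow> dist_int y < r \<and> k = round y" for k :: int
  proof
    assume *: "\<bar>y - of_int k\<bar> < r"
    then have "round y = k" using assms(1) by (intro round_unique') linarith
    with * show "dist_int y < r \<and> k = round y" by (simp add: dist_int_def)
  qed (simp add: dist_int_def)
  then show ?thesis
    using assms(2,3) by (simp add: of_bool_conj sum.delta if_distrib of_bool_def cong: if_cong)
qed

lemma integrable_indicator_cover:
  assumes "0 \<le> c"
  shows "integrable lborel (\<lambda>v. indicator {- r<..<r} v * cover c (u + v))"
proof -
  have "\<bar>cover c (u + v)\<bar> \<le> 2 * c + 1" for v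
    using cover_nonneg[OF assms, of "u + v"] cover_upper[of c "u + v"] by simp
  moreover have "emeasure lborel {- r<..<r} < \<infinity>"
    by (cases "- r \<le> r") auto
  ultimately show ?thesis
    using integrableI_bounded_set_indicator[of "{- r<..<r}" lborel "\<lambda>v. cover c (u + v)" "2 * c + 1"]
    by simp
qed

text \<open>The event splits into disjoint windows about the points \<open>u + k\<close>.
  Translating each to the window about 0 and summing over \<open>k\<close> first gives
  \<open>cover\<close>, so the integrand is the density modulo 1 of the uniform law.\<close>

lemma measure_uniform_dist_int:
  assumes c: "0 < c" and r: "0 < r" "r \<le> 1 / 2"
  shows "measure (uniform_measure lborel {- c..c}) {z. dist_int (z - u) < r}
    = (\<integral>v. indicator {- r<..<r} v * (cover c (u + v) / (2 * c)) \<partial>lborel)"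
proof -
  \<comment> \<open>One finite index set for both sums: it contains \<open>round (z - u)\<close> for
    \<open>z\<close> in \<open>{- c..c}\<close> and every integer counted by
    \<open>cover c (u + v)\<close> when \<open>\<bar>v\<bar> < r\<close>.\<close>
  define B where "B = \<lceil>c + \<bar>u\<bar>\<rceil> + 2"
  define K where "K = {- B..B}"
  define I where "I k = {- c..c} \<inter> {u + of_int k - r<..<u + of_int k + r}" for k :: int
  have [measurable]: "I k \<in> sets borel" for k
    unfolding I_def by measurable
  have I_fin: "emeasure lborel (I k) < \<infinity>" for k
    by (rule emeasure_bounded_finite) (auto simp: I_def intro: bounded_subset[OF bounded_closed_interval])
  have I_int: "integrable lborel (indicator (I k) :: real \<Rightarrow> real)" for k
    using I_fin[of k] by (intro integrable_real_indicator) auto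
  have S: "{z. dist_int (z - u) < r} \<in> sets borel"
    by measurable
  have "measure lborel ({- c..c} \<inter> {z. dist_int (z - u) < r})
      = (\<integral>z. indicator ({- c..c} \<inter> {z. dist_int (z - u) < r}) z \<partial>lborel)"
    by simp
  also have "\<dots> = (\<integral>z. (\<Sum>k\<in>K. indicator (I k) z) \<partial>lborel)"
  proof (rule Bochner_Integration.integral_cong[OF refl])
    fix z :: real
    show "indicator ({- c..c} \<inter> {z. dist_int (z - u) < r}) z = (\<Sum>k\<in>K. indicator (I k) z :: real)"
    proof (cases "z \<in> {- c..c}")
      case True
      then have "round (z - u) \<in> K"
        unfolding K_def B_def round_def by (auto simp: abs_le_iff) linarith+
      then have "(of_bool (dist_int (z - u) < r) :: real) = (\<Sum>k\<in>K. of_bool (\<bar>z - u - of_int k\<bar> < r))"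
        by (intro indicator_dist_int_eq_sum r) (simp_all add: K_def)
      also have "\<dots> = (\<Sum>k\<in>K. indicator (I k) z)"
        using True by (intro sum.cong refl) (auto simp: I_def indicator_def)
      finally show ?thesis using True by (simp add: indicator_def)
    qed (auto simp: I_def indicator_def intro!: sum.neutral)
  qed
  also have "\<dots> = (\<Sum>k\<in>K. \<integral>z. indicator (I k) z \<partial>lborel)"
    using I_int by (intro Bochner_Integration.integral_sum) auto
  also have "\<dots> = (\<Sum>k\<in>K. \<integral>v. indicator (I k) (u + of_int k + v) \<partial>lborel)"
    by (intro sum.cong refl, subst lborel_integral_real_affine[of 1 _ "u + of_int _"]) auto
  also have "\<dots> = (\<integral>v. (\<Sum>k\<in>K. indicator (I k) (u + of_int k + v)) \<partial>lborel)"
    using lborel_integrable_real_affine[OF I_int, of 1]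
    by (intro Bochner_Integration.integral_sum[symmetric]) auto
  also have "\<dots> = (\<integral>v. indicator {- r<..<r} v * cover c (u + v) \<partial>lborel)"
  proof (rule Bochner_Integration.integral_cong[OF refl])
    fix v :: real
    show "(\<Sum>k\<in>K. indicator (I k) (u + of_int k + v)) = indicator {- r<..<r} v * cover c (u + v)"
    proof (cases "v \<in> {- r<..<r}")
      case True
      have "(\<Sum>k\<in>K. indicator (I k) (u + of_int k + v)) = (\<Sum>k\<in>K. of_bool (\<bar>u + v + of_int k\<bar> \<le> c) :: real)"
        using True by (intro sum.cong refl) (auto simp: I_def indicator_def abs_le_iff)
      also have "\<dots> = cover c (u + v)"
      proof (rule sum_of_bool_eq_cover)
        show "{\<lceil>- c - (u + v)\<rceil>..\<lfloor>c - (u + v)\<rfloor>} \<subseteq> K"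
          using True r unfolding K_def B_def by (auto simp: abs_le_iff) linarith+
      qed (use c in \<open>auto simp: K_def\<close>)
      finally show ?thesis using True by simp
    qed (auto simp: I_def indicator_def intro!: sum.neutral)
  qed
  finally have "measure lborel ({- c..c} \<inter> {z. dist_int (z - u) < r}) = \<dots>" .
  then show ?thesis
    using c S by (simp add: measure_uniform_measure)
qed

section \<open>Moments of the pair count\<close>

lemma sets_Collect_pair:
  assumes "Measurable.pred (S \<Otimes>\<^sub>M T) P" "space S = UNIV" "space T = UNIV"
  shows "{p. P p} \<in> sets (S \<Otimes>\<^sub>M T)"
  using assms by (auto simp: pred_def space_pair_measure)

section \<open>Conditioning on one of two independent variables\<close>

context prob_space
begin

lemma borel_measurable_prob_section:
  assumes Z [measurable]: "Z \<in> measurable M T" and A [measurable]: "A \<in> sets (S \<Otimes>\<^sub>M T)"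
  shows "(\<lambda>t. prob {\<omega> \<in> space M. (t, Z \<omega>) \<in> A}) \<in> borel_measurable S"
proof -
  define Q where "Q = (\<lambda>(t, \<omega>). (t, Z \<omega>)) -` A \<inter> space (S \<Otimes>\<^sub>M M)"
  have Q: "Q \<in> sets (S \<Otimes>\<^sub>M M)"
    unfolding Q_def by (intro measurable_sets[of _ _ "S \<Otimes>\<^sub>M T"]) measurable
  have "(\<lambda>t. enn2real (emeasure M (Pair t -` Q))) \<in> borel_measurable S"
    using measurable_emeasure_Pair[OF Q] by measurable
  moreover have "enn2real (emeasure M (Pair t -` Q)) = prob {\<omega> \<in> space M. (t, Z \<omega>) \<in> A}"
    if "t \<in> space S" for t
    using that by (auto simp: Q_def measure_def space_pair_measure intro!: arg_cong[where f = "\<lambda>X. enn2real (emeasure M X)"])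
  ultimately show ?thesis
    by (simp cong: measurable_cong)
qed

text \<open>Independence makes the joint law a product, and Tonelli evaluates it by fixing
  \<open>X\<close> and integrating the section probabilities.\<close>

lemma prob_indep_var_eq_expectation:
  assumes ind: "indep_var S X T Z" and A: "A \<in> sets (S \<Otimes>\<^sub>M T)"
  shows "prob {\<omega> \<in> space M. (X \<omega>, Z \<omega>) \<in> A}
      = expectation (\<lambda>\<omega>. prob {\<omega>' \<in> space M. (X \<omega>, Z \<omega>') \<in> A})"
proof -
  have X [measurable]: "X \<in> measurable M S" and Z [measurable]: "Z \<in> measurable M T"
    using ind by (auto dest: indep_var_rv1 indep_var_rv2)
  have joint: "distr M S X \<Otimes>\<^sub>M distr M T Z = distr M (S \<Otimes>\<^sub>M T) (\<lambda>\<omega>. (X \<omega>, Z \<omega>))"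
    using ind by (simp add: indep_var_distribution_eq)
  interpret Z: prob_space "distr M T Z"
    by (rule prob_space_distr) measurable
  have sec: "emeasure (distr M T Z) (Pair t -` A) = ennreal (prob {\<omega>' \<in> space M. (t, Z \<omega>') \<in> A})" for t
  proof -
    have "emeasure (distr M T Z) (Pair t -` A) = emeasure M (Z -` (Pair t -` A) \<inter> space M)"
      using A by (intro emeasure_distr sets_Pair1) auto
    also have "Z -` (Pair t -` A) \<inter> space M = {\<omega>' \<in> space M. (t, Z \<omega>') \<in> A}"
      by auto
    finally show ?thesis by (simp add: emeasure_eq_measure)
  qed
  have A': "A \<in> sets (distr M S X \<Otimes>\<^sub>M distr M T Z)"
    using A by (simp cong: sets_pair_measure_cong)
  note meas [measurable] = borel_measurable_prob_section[OF Z A]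
  have "ennreal (prob {\<omega> \<in> space M. (X \<omega>, Z \<omega>) \<in> A})
      = emeasure M ((\<lambda>\<omega>. (X \<omega>, Z \<omega>)) -` A \<inter> space M)"
    by (auto simp: emeasure_eq_measure intro!: arg_cong[where f = prob])
  also have "\<dots> = emeasure (distr M S X \<Otimes>\<^sub>M distr M T Z) A"
    unfolding joint using A by (subst emeasure_distr) auto
  also have "\<dots> = (\<integral>\<^sup>+t. ennreal (prob {\<omega>' \<in> space M. (t, Z \<omega>') \<in> A}) \<partial>distr M S X)"
    using A' by (simp add: Z.emeasure_pair_measure_alt sec)
  also have "\<dots> = (\<integral>\<^sup>+\<omega>. ennreal (prob {\<omega>' \<in> space M. (X \<omega>, Z \<omega>') \<in> A}) \<partial>M)"
    by (subst nn_integral_distr) auto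
  also have "\<dots> = ennreal (expectation (\<lambda>\<omega>. prob {\<omega>' \<in> space M. (X \<omega>, Z \<omega>') \<in> A}))"
    using measurable_compose[OF X meas]
    by (intro nn_integral_eq_integral integrable_const_bound[where B = 1]) auto
  finally show ?thesis
    by (simp add: Bochner_Integration.integral_nonneg)
qed

section \<open>Events that two points are close, and their moments\<close>

definition near_prob :: "(nat \<Rightarrow> 'a \<Rightarrow> real) \<Rightarrow> real \<Rightarrow> nat \<Rightarrow> real \<Rightarrow> real" where
  "near_prob Y r n t = prob {\<omega> \<in> space M. dist_int (Y n \<omega> - t) < r}"

definition near_event :: "(nat \<Rightarrow> 'a \<Rightarrow> real) \<Rightarrow> real \<Rightarrow> nat \<Rightarrow> nat \<Rightarrow> 'a set" where
  "near_event Y r m n = {\<omega> \<in> space M. dist_int (Y m \<omega> - Y n \<omega>) < r}"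

lemma near_event_commute: "near_event Y r m n = near_event Y r n m"
  by (simp add: near_event_def dist_int_diff_commute)

lemma near_prob_nonneg: "0 \<le> near_prob Y r n t"
  by (simp add: near_prob_def)

lemma near_prob_le_1: "near_prob Y r n t \<le> 1"
  by (simp add: near_prob_def)

lemma near_prob_measurable [measurable]:
  assumes [measurable]: "Y n \<in> borel_measurable M"
  shows "near_prob Y r n \<in> borel_measurable borel"
proof -
  have "{p. dist_int (snd p - fst p) < r} \<in> sets (borel \<Otimes>\<^sub>M borel)"
    by (rule sets_Collect_pair) auto
  from borel_measurable_prob_section[OF assms this] show ?thesis
    unfolding near_prob_def[abs_def] by simp
qed

lemma near_event_sets [measurable]:
  assumes [measurable]: "Y m \<in> borel_measurable M" "Y n \<in> borel_measurable M"
  shows "near_event Y r m n \<in> sets M"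
  unfolding near_event_def by measurable

context
  fixes Y :: "nat \<Rightarrow> 'a \<Rightarrow> real" and I :: "nat set"
  assumes indep: "indep_vars (\<lambda>_. borel) Y I"
begin

lemma indep_vars_borel_measurable: "n \<in> I \<Longrightarrow> Y n \<in> borel_measurable M"
  using indep by (auto simp: indep_vars_def)

lemma indep_var_tuples:
  assumes "A \<subseteq> I" "B \<subseteq> I" "A \<inter> B = {}"
    and "f \<in> measurable (PiM A (\<lambda>_. borel)) S" "h \<in> measurable (PiM B (\<lambda>_. borel)) T"
  shows "indep_var S (\<lambda>\<omega>. f (restrict (\<lambda>i. Y i \<omega>) A)) T (\<lambda>\<omega>. h (restrict (\<lambda>i. Y i \<omega>) B))"
  using indep_var_compose[OF indep_var_restrict[OF indep assms(3,1,2)] assms(4,5)]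
  by (simp add: comp_def)

lemma indep_var_1_1:
  assumes "m \<in> I" "n \<in> I" "m \<noteq> n"
  shows "indep_var borel (Y m) borel (Y n)"
  using indep_var_tuples[of "{m}" "{n}" "\<lambda>f. f m" borel "\<lambda>f. f n" borel] assms by simp

lemma indep_var_2_2:
  assumes "m \<in> I" "n \<in> I" "k \<in> I" "l \<in> I" "{m, n} \<inter> {k, l} = {}"
  shows "indep_var (borel \<Otimes>\<^sub>M borel) (\<lambda>\<omega>. (Y m \<omega>, Y n \<omega>)) (borel \<Otimes>\<^sub>M borel) (\<lambda>\<omega>. (Y k \<omega>, Y l \<omega>))"
  using indep_var_tuples[of "{m, n}" "{k, l}" "\<lambda>f. (f m, f n)" "borel \<Otimes>\<^sub>M borel" "\<lambda>f. (f k, f l)" "borel \<Otimes>\<^sub>M borel"] assms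
  by simp

lemma prob_near_event:
  assumes "m \<in> I" "n \<in> I" "m \<noteq> n"
  shows "prob (near_event Y r m n) = expectation (\<lambda>\<omega>. near_prob Y r n (Y m \<omega>))"
proof -
  have "{p. dist_int (snd p - fst p) < r} \<in> sets (borel \<Otimes>\<^sub>M borel)"
    by (rule sets_Collect_pair) auto
  from prob_indep_var_eq_expectation[OF indep_var_1_1[OF assms] this] show ?thesis
    by (simp add: near_event_def near_prob_def dist_int_diff_commute[of "Y m _"])
qed

text \<open>Given \<open>Y m\<close>, the closeness of \<open>Y n\<close> and that of
  \<open>Y l\<close> to it are independent, so the conditional probability factors.\<close>

lemma prob_near_event_Int:
  assumes "m \<in> I" "n \<in> I" "l \<in> I" "m \<noteq> n" "m \<noteq> l" "n \<noteq> l"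
  shows "prob (near_event Y r m n \<inter> near_event Y r m l)
    = expectation (\<lambda>\<omega>. near_prob Y r n (Y m \<omega>) * near_prob Y r l (Y m \<omega>))"
proof -
  have A: "{p. dist_int (fst (snd p) - fst (fst p)) < r \<and> dist_int (snd (snd p) - fst (fst p)) < r}
      \<in> sets ((borel \<Otimes>\<^sub>M (borel :: real measure)) \<Otimes>\<^sub>M (borel \<Otimes>\<^sub>M borel))"
    by (rule sets_Collect_pair) (auto simp: space_pair_measure)
  \<comment> \<open>\<open>Y m\<close> is doubled to fit \<open>indep_var_2_2\<close>; the event
    reads only the first copy.\<close>
  have ind: "indep_var (borel \<Otimes>\<^sub>M borel) (\<lambda>\<omega>. (Y m \<omega>, Y m \<omega>)) (borel \<Otimes>\<^sub>M borel) (\<lambda>\<omega>. (Y n \<omega>, Y l \<omega>))"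
    using assms by (intro indep_var_2_2) auto
  have B: "{y. dist_int (y - t) < r} \<in> sets borel" for t
    by measurable
  have "near_event Y r m n \<inter> near_event Y r m l
      = {\<omega> \<in> space M. dist_int (Y n \<omega> - Y m \<omega>) < r \<and> dist_int (Y l \<omega> - Y m \<omega>) < r}"
    by (auto simp: near_event_def dist_int_diff_commute[of "Y m _"])
  moreover have "prob {\<omega>' \<in> space M. dist_int (Y n \<omega>' - t) < r \<and> dist_int (Y l \<omega>' - t) < r}
      = near_prob Y r n t * near_prob Y r l t" for t
  proof -
    have "prob ((\<lambda>x. (Y n x, Y l x)) -` ({y. dist_int (y - t) < r} \<times> {y. dist_int (y - t) < r}) \<inter> space M)
        = prob (Y n -` {y. dist_int (y - t) < r} \<inter> space M) * prob (Y l -` {y. dist_int (y - t) < r} \<inter> space M)"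
      by (rule indep_varD[OF indep_var_1_1[OF assms(2,3,6)] B B])
    then show ?thesis
      unfolding near_prob_def by (simp add: vimage_def Int_def conj_commute)
  qed
  ultimately show ?thesis
    using prob_indep_var_eq_expectation[OF ind A] by simp
qed

lemma prob_near_event_disjoint:
  assumes "m \<in> I" "n \<in> I" "k \<in> I" "l \<in> I" "{m, n} \<inter> {k, l} = {}"
  shows "prob (near_event Y r m n \<inter> near_event Y r k l) = prob (near_event Y r m n) * prob (near_event Y r k l)"
proof -
  have B: "{p. dist_int (fst p - snd p) < r} \<in> sets (borel \<Otimes>\<^sub>M borel)"
    by (rule sets_Collect_pair) auto
  show ?thesis
    using indep_varD[OF indep_var_2_2[OF assms] B B]
    unfolding near_event_def by (simp add: vimage_def Int_def conj_ac)
qed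

lemma integrable_near_prob:
  assumes "m \<in> I" "n \<in> I"
  shows "integrable M (\<lambda>\<omega>. near_prob Y r n (Y m \<omega>))"
  using assms near_prob_nonneg near_prob_le_1 measurable_compose[OF indep_vars_borel_measurable[OF assms(1)] near_prob_measurable[where Y = Y, OF indep_vars_borel_measurable[OF assms(2)]]]
  by (intro integrable_const_bound[where B = 1]) auto

text \<open>Given \<open>Y m\<close>, summing over \<open>l\<close> costs at most the factor
  \<open>C\<close>. The additional 1 comes from \<open>l = n\<close>, where the intersection is the
  event itself.\<close>

lemma sum_prob_near_event_Int:
  assumes fin: "finite I" and mn: "m \<in> I" "n \<in> I" "m \<noteq> n"
    and C: "\<And>t. (\<Sum>l\<in>I. near_prob Y r l t) \<le> C"
  shows "(\<Sum>l\<in>I - {m}. prob (near_event Y r m n \<inter> near_event Y r m l)) \<le> (C + 1) * prob (near_event Y r m n)"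
proof -
  have int2: "integrable M (\<lambda>\<omega>. near_prob Y r n (Y m \<omega>) * near_prob Y r l (Y m \<omega>))" if "l \<in> I" for l
    using near_prob_nonneg near_prob_le_1 mn that indep_vars_borel_measurable[OF mn(1)] indep_vars_borel_measurable[OF mn(2)] indep_vars_borel_measurable[OF that]
    by (intro integrable_const_bound[where B = 1]) (auto simp: abs_mult intro!: mult_le_one)
  have "(\<Sum>l\<in>I - {m} - {n}. prob (near_event Y r m n \<inter> near_event Y r m l))
      = (\<Sum>l\<in>I - {m} - {n}. expectation (\<lambda>\<omega>. near_prob Y r n (Y m \<omega>) * near_prob Y r l (Y m \<omega>)))"
    using mn by (intro sum.cong refl prob_near_event_Int) auto
  also have "\<dots> = expectation (\<lambda>\<omega>. \<Sum>l\<in>I - {m} - {n}. near_prob Y r n (Y m \<omega>) * near_prob Y r l (Y m \<omega>))"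
    using int2 by (intro Bochner_Integration.integral_sum[symmetric]) auto
  also have "\<dots> \<le> expectation (\<lambda>\<omega>. C * near_prob Y r n (Y m \<omega>))"
  proof (rule integral_mono)
    fix \<omega>
    have "(\<Sum>l\<in>I - {m} - {n}. near_prob Y r l (Y m \<omega>)) \<le> (\<Sum>l\<in>I. near_prob Y r l (Y m \<omega>))"
      using fin near_prob_nonneg by (intro sum_mono2) auto
    also have "\<dots> \<le> C" by (rule C)
    finally have "near_prob Y r n (Y m \<omega>) * (\<Sum>l\<in>I - {m} - {n}. near_prob Y r l (Y m \<omega>)) \<le> near_prob Y r n (Y m \<omega>) * C"
      using near_prob_nonneg by (intro mult_left_mono) auto
    then show "(\<Sum>l\<in>I - {m} - {n}. near_prob Y r n (Y m \<omega>) * near_prob Y r l (Y m \<omega>)) \<le> C * near_prob Y r n (Y m \<omega>)"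
      by (simp add: sum_distrib_left mult.commute)
  qed (use int2 integrable_near_prob[OF mn(1,2)] in auto)
  also have "\<dots> = C * prob (near_event Y r m n)"
    using prob_near_event[OF mn] by simp
  finally show ?thesis
    using fin mn by (simp add: sum.remove[of "I - {m}" n] algebra_simps)
qed

text \<open>The variance is a sum of covariances of ordered pairs, and disjoint pairs contribute 0.
  A pair meeting \<open>p\<close> shares one of its two indices, in first or second position: four
  families, each of total at most \<open>(C + 1) * prob (A p)\<close>.\<close>

lemma variance_near_pairs:
  assumes fin: "finite I" and C: "\<And>t. (\<Sum>l\<in>I. near_prob Y r l t) \<le> C"
  defines "P \<equiv> SIGMA m:I. I - {m}"
  defines "X \<equiv> \<lambda>\<omega>. \<Sum>(m, n)\<in>P. indicator (near_event Y r m n) \<omega> :: real"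
  shows "integrable M (\<lambda>\<omega>. (X \<omega> - expectation X)\<^sup>2)"
    and "expectation X = (\<Sum>(m, n)\<in>P. prob (near_event Y r m n))"
    and "expectation (\<lambda>\<omega>. (X \<omega> - expectation X)\<^sup>2) \<le> 4 * (C + 1) * expectation X"
proof -
  define A where "A p = near_event Y r (fst p) (snd p)" for p
  have finP: "finite P" using fin by (simp add: P_def)
  have A_sets [measurable]: "A p \<in> sets M" if "p \<in> P" for p
    using that indep_vars_borel_measurable by (auto simp: A_def P_def)
  have X: "X \<omega> = (\<Sum>p\<in>P. indicator (A p) \<omega>)" for \<omega>
    by (simp add: X_def A_def case_prod_beta)
  have intA: "integrable M (indicator (A p) :: 'a \<Rightarrow> real)" if "p \<in> P" for p
    using that by (intro integrable_real_indicator) (auto simp: emeasure_eq_measure)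
  have intAA: "integrable M (indicator (A p \<inter> A p') :: 'a \<Rightarrow> real)" if "p \<in> P" "p' \<in> P" for p p'
    using that by (intro integrable_real_indicator) (auto simp: emeasure_eq_measure)
  have intX: "integrable M X"
    unfolding X[abs_def] using intA by auto
  have X2: "(X \<omega>)\<^sup>2 = (\<Sum>p\<in>P. \<Sum>p'\<in>P. indicator (A p \<inter> A p') \<omega>)" for \<omega>
    by (simp add: X power2_eq_square sum_product indicator_inter_arith)
  have intX2: "integrable M (\<lambda>\<omega>. (X \<omega>)\<^sup>2)"
    unfolding X2 using intAA by auto
  show "integrable M (\<lambda>\<omega>. (X \<omega> - expectation X)\<^sup>2)"
    using intX intX2 by (simp add: power2_diff)
  have EX': "expectation X = (\<Sum>p\<in>P. prob (A p))"
    unfolding X[abs_def] using intA A_sets by (subst Bochner_Integration.integral_sum) auto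
  then show EX: "expectation X = (\<Sum>(m, n)\<in>P. prob (near_event Y r m n))"
    by (simp add: A_def case_prod_beta)
  have EX2: "expectation (\<lambda>\<omega>. (X \<omega>)\<^sup>2) = (\<Sum>p\<in>P. \<Sum>p'\<in>P. prob (A p \<inter> A p'))"
  proof -
    have "expectation (\<lambda>\<omega>. (X \<omega>)\<^sup>2) = (\<Sum>p\<in>P. expectation (\<lambda>\<omega>. \<Sum>p'\<in>P. indicator (A p \<inter> A p') \<omega>))"
      unfolding X2 using intAA by (intro Bochner_Integration.integral_sum) auto
    also have "\<dots> = (\<Sum>p\<in>P. \<Sum>p'\<in>P. expectation (indicator (A p \<inter> A p')))"
      using intAA by (intro sum.cong refl Bochner_Integration.integral_sum) auto
    also have "\<dots> = (\<Sum>p\<in>P. \<Sum>p'\<in>P. prob (A p \<inter> A p'))"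
      using A_sets by (intro sum.cong refl Bochner_Integration.integral_indicator[THEN trans]) (auto simp: Int_absorb2 sets.sets_into_space)
    finally show ?thesis .
  qed
  have sumP: "(\<Sum>p\<in>P. of_bool (fst p = k) * w p) = (\<Sum>l\<in>I - {k}. w (k, l))" if "k \<in> I" for k and w :: "nat \<times> nat \<Rightarrow> real"
  proof -
    have "(\<Sum>p\<in>P. of_bool (fst p = k) * w p) = (\<Sum>a\<in>I. \<Sum>b\<in>I - {a}. of_bool (a = k) * w (a, b))"
      unfolding P_def using fin by (subst sum.Sigma) (auto simp: case_prod_beta)
    also have "\<dots> = (\<Sum>a\<in>I. if a = k then \<Sum>b\<in>I - {a}. w (a, b) else 0)"
      by (intro sum.cong) auto
    also have "\<dots> = (\<Sum>l\<in>I - {k}. w (k, l))"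
      using fin that by simp
    finally show ?thesis .
  qed
  have sumP': "(\<Sum>p\<in>P. of_bool (snd p = k) * prob (A q \<inter> A p)) = (\<Sum>p\<in>P. of_bool (fst p = k) * prob (A q \<inter> A p))" for k q
    by (rule sum.reindex_bij_witness[of _ prod.swap prod.swap])
       (auto simp: P_def A_def near_event_commute)
  have bound: "(\<Sum>l\<in>I - {m}. prob (A p \<inter> A (m, l))) \<le> (C + 1) * prob (A p)"
    if p: "p \<in> P" and m: "m = fst p \<or> m = snd p" for p m
  proof -
    obtain a b where ab: "p = (a, b)" "a \<in> I" "b \<in> I" "a \<noteq> b" "b \<noteq> a"
      using p by (auto simp: P_def)
    from m show ?thesis
      using sum_prob_near_event_Int[OF fin ab(2,3,4) C] sum_prob_near_event_Int[OF fin ab(3,2,5) C]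
      unfolding ab(1) by (auto simp: A_def near_event_commute[of Y r b a])
  qed
  have "expectation (\<lambda>\<omega>. (X \<omega> - expectation X)\<^sup>2) = expectation (\<lambda>\<omega>. (X \<omega>)\<^sup>2) - (expectation X)\<^sup>2"
    using intX intX2 by (rule variance_eq)
  also have "\<dots> = (\<Sum>p\<in>P. \<Sum>p'\<in>P. prob (A p \<inter> A p') - prob (A p) * prob (A p'))"
    unfolding EX2 EX' by (simp add: power2_eq_square sum_product sum_subtractf)
  also have "\<dots> \<le> (\<Sum>p\<in>P. 4 * (C + 1) * prob (A p))"
  proof (rule sum_mono)
    fix p assume p: "p \<in> P"
    define m n where "m = fst p" and "n = snd p"
    have mnI: "m \<in> I" "n \<in> I" using p by (auto simp: P_def m_def n_def)
    have "(\<Sum>p'\<in>P. prob (A p \<inter> A p') - prob (A p) * prob (A p'))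
        \<le> (\<Sum>p'\<in>P. of_bool (fst p' = m) * prob (A p \<inter> A p') + of_bool (snd p' = m) * prob (A p \<inter> A p')
            + of_bool (fst p' = n) * prob (A p \<inter> A p') + of_bool (snd p' = n) * prob (A p \<inter> A p'))"
    proof (rule sum_mono)
      fix p' assume p': "p' \<in> P"
      show "prob (A p \<inter> A p') - prob (A p) * prob (A p')
        \<le> of_bool (fst p' = m) * prob (A p \<inter> A p') + of_bool (snd p' = m) * prob (A p \<inter> A p')
            + of_bool (fst p' = n) * prob (A p \<inter> A p') + of_bool (snd p' = n) * prob (A p \<inter> A p')"
      proof (cases "{m, n} \<inter> {fst p', snd p'} = {}")
        case True
        then have "prob (A p \<inter> A p') = prob (A p) * prob (A p')"
          unfolding A_def m_def n_def using p p' by (intro prob_near_event_disjoint) (auto simp: P_def)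
        then show ?thesis by simp
      next
        case False
        \<comment> \<open>At least one of the four indicators is 1; counting a pair several times
          only enlarges the bound.\<close>
        then have "1 \<le> (of_bool (fst p' = m) + of_bool (snd p' = m) + of_bool (fst p' = n) + of_bool (snd p' = n) :: real)"
          by auto
        then have "1 * prob (A p \<inter> A p') \<le> (of_bool (fst p' = m) + of_bool (snd p' = m)
            + of_bool (fst p' = n) + of_bool (snd p' = n)) * prob (A p \<inter> A p')"
          by (intro mult_right_mono) auto
        moreover have "0 \<le> prob (A p) * prob (A p')" by simp
        ultimately show ?thesis
          unfolding distrib_right by linarith
      qed
    qed
    also have "\<dots> = 2 * (\<Sum>l\<in>I - {m}. prob (A p \<inter> A (m, l))) + 2 * (\<Sum>l\<in>I - {n}. prob (A p \<inter> A (n, l)))"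
      unfolding sum.distrib sumP' using mnI by (simp add: sumP)
    also have "\<dots> \<le> 4 * (C + 1) * prob (A p)"
      using bound[OF p, of m] bound[OF p, of n] unfolding mult.assoc m_def n_def by linarith
    finally show "(\<Sum>p'\<in>P. prob (A p \<inter> A p') - prob (A p) * prob (A p')) \<le> 4 * (C + 1) * prob (A p)" .
  qed
  also have "\<dots> = 4 * (C + 1) * expectation X"
    unfolding EX' by (simp add: sum_distrib_left)
  finally show "expectation (\<lambda>\<omega>. (X \<omega> - expectation X)\<^sup>2) \<le> 4 * (C + 1) * expectation X" .
qed

text \<open>Given \<open>Y m\<close>, the expected number of close partners is the full sum at
  \<open>t = Y m\<close> without the term of index \<open>m\<close>, which is at most
  \<open>d\<close>.\<close>

lemma sum_prob_near_event_approx: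
  assumes fin: "finite I" and C: "\<And>t. \<bar>(\<Sum>l\<in>I. near_prob Y r l t) - \<mu>\<bar> \<le> \<eta>"
    and d: "\<And>m t. m \<in> I \<Longrightarrow> near_prob Y r m t \<le> d"
  shows "\<bar>(\<Sum>(m, n)\<in>(SIGMA m:I. I - {m}). prob (near_event Y r m n)) - real (card I) * \<mu>\<bar>
    \<le> real (card I) * (\<eta> + d)"
proof -
  have each: "\<bar>(\<Sum>n\<in>I - {m}. prob (near_event Y r m n)) - \<mu>\<bar> \<le> \<eta> + d" if m: "m \<in> I" for m
  proof -
    have "(\<Sum>n\<in>I - {m}. prob (near_event Y r m n)) = (\<Sum>n\<in>I - {m}. expectation (\<lambda>\<omega>. near_prob Y r n (Y m \<omega>)))"
      using m by (intro sum.cong refl prob_near_event) auto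
    also have "\<dots> = expectation (\<lambda>\<omega>. \<Sum>n\<in>I - {m}. near_prob Y r n (Y m \<omega>))"
      using m integrable_near_prob by (intro Bochner_Integration.integral_sum[symmetric]) auto
    finally have eq: "(\<Sum>n\<in>I - {m}. prob (near_event Y r m n)) = \<dots>" .
    have int: "integrable M (\<lambda>\<omega>. \<Sum>n\<in>I - {m}. near_prob Y r n (Y m \<omega>))"
      using m integrable_near_prob by auto
    have b: "\<mu> - (\<eta> + d) \<le> (\<Sum>n\<in>I - {m}. near_prob Y r n t)" "(\<Sum>n\<in>I - {m}. near_prob Y r n t) \<le> \<mu> + (\<eta> + d)" for t
      using C[of t] d[OF m, of t] near_prob_nonneg[of Y r m t] sum.remove[OF fin m, of "\<lambda>n. near_prob Y r n t"]
      by linarith+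
    have "expectation (\<lambda>\<omega>. \<Sum>n\<in>I - {m}. near_prob Y r n (Y m \<omega>)) \<le> \<mu> + (\<eta> + d)"
      using int b(2) by (intro integral_le_const) auto
    moreover have "expectation (\<lambda>\<omega>. \<Sum>n\<in>I - {m}. near_prob Y r n (Y m \<omega>)) \<ge> \<mu> - (\<eta> + d)"
      using int b(1) by (intro integral_ge_const) auto
    ultimately show ?thesis
      unfolding eq by linarith
  qed
  have "(\<Sum>(m, n)\<in>(SIGMA m:I. I - {m}). prob (near_event Y r m n)) - real (card I) * \<mu>
      = (\<Sum>m\<in>I. (\<Sum>n\<in>I - {m}. prob (near_event Y r m n)) - \<mu>)"
    using fin by (subst sum.Sigma[symmetric]) (auto simp: sum_subtractf)
  also have "\<bar>\<dots>\<bar> \<le> (\<Sum>m\<in>I. \<eta> + d)"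
    using each by (intro order_trans[OF sum_abs] sum_mono) auto
  finally show ?thesis by simp
qed

end

text \<open>By Tonelli the sum of the squares has finite expectation, so it is finite almost surely
  and its terms tend to 0.\<close>

lemma AE_tendsto_zero_of_summable_second_moments:
  fixes Z :: "nat \<Rightarrow> 'a \<Rightarrow> real"
  assumes int: "\<And>k. integrable M (\<lambda>\<omega>. (Z k \<omega>)\<^sup>2)"
    and sum: "summable (\<lambda>k. expectation (\<lambda>\<omega>. (Z k \<omega>)\<^sup>2))"
  shows "AE \<omega> in M. (\<lambda>k. Z k \<omega>) \<longlonglongrightarrow> 0"
proof -
  have [measurable]: "(\<lambda>\<omega>. (Z k \<omega>)\<^sup>2) \<in> borel_measurable M" for k
    using int by auto
  have "(\<integral>\<^sup>+\<omega>. (\<Sum>k. ennreal ((Z k \<omega>)\<^sup>2)) \<partial>M) = (\<Sum>k. \<integral>\<^sup>+\<omega>. ennreal ((Z k \<omega>)\<^sup>2) \<partial>M)"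
    by (rule nn_integral_suminf) measurable
  also have "\<dots> = (\<Sum>k. ennreal (expectation (\<lambda>\<omega>. (Z k \<omega>)\<^sup>2)))"
    using int by (simp add: nn_integral_eq_integral)
  also have "\<dots> \<noteq> \<infinity>"
    using sum by (subst suminf_ennreal2) auto
  finally have "AE \<omega> in M. (\<Sum>k. ennreal ((Z k \<omega>)\<^sup>2)) \<noteq> \<infinity>"
    by (intro nn_integral_noteq_infinite) auto
  then show ?thesis
  proof eventually_elim
    case (elim \<omega>)
    then have "summable (\<lambda>k. (Z k \<omega>)\<^sup>2)"
      by (intro summable_suminf_not_top) auto
    then have "(\<lambda>k. (Z k \<omega>)\<^sup>2) \<longlonglongrightarrow> 0"
      by (rule summable_LIMSEQ_zero)
    then show ?case
      by (rule power_tendsto_0_iff[THEN iffD1, rotated]) simp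
  qed
qed

end

section \<open>Almost sure convergence\<close>

text \<open>The radius is not tied to \<open>N\<close>, so that counts can be compared monotonically
  in both arguments.\<close>

definition pair_count :: "(nat \<Rightarrow> real) \<Rightarrow> nat \<Rightarrow> real \<Rightarrow> nat" where
  "pair_count y N r =
     card {(m, n). m \<in> {1..N} \<and> n \<in> {1..N} \<and> m \<noteq> n \<and> dist_int (y m - y n) < r}"

lemma pair_count_mono: "N \<le> N' \<Longrightarrow> r \<le> r' \<Longrightarrow> pair_count y N r \<le> pair_count y N' r'"
  unfolding pair_count_def
  by (rule card_mono[OF finite_subset[of _ "{1..N'} \<times> {1..N'}"]]) auto

text \<open>The largest \<open>k\<close> with \<open>k\<^sup>2 \<le> N\<close> tends to infinity
  with \<open>N\<close>.\<close>

lemma eventually_between_squares: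
  assumes "eventually P sequentially"
  shows "eventually (\<lambda>N. \<exists>k. P k \<and> k\<^sup>2 \<le> N \<and> N \<le> (Suc k)\<^sup>2) sequentially"
proof -
  obtain k0 where k0: "\<And>k. k \<ge> k0 \<Longrightarrow> P k"
    using assms by (auto simp: eventually_sequentially)
  have ex: "\<exists>k. k\<^sup>2 \<le> N \<and> N < (Suc k)\<^sup>2" for N :: nat
  proof (induction N)
    case 0
    show ?case by (rule exI[of _ 0]) simp
  next
    case (Suc N)
    then obtain k where k: "k\<^sup>2 \<le> N" "N < (Suc k)\<^sup>2" by blast
    show ?case
    proof (cases "Suc N < (Suc k)\<^sup>2")
      case True
      with k show ?thesis by (intro exI[of _ k]) auto
    next
      case False
      with k have "Suc N = (Suc k)\<^sup>2" by simp
      then show ?thesis by (intro exI[of _ "Suc k"]) (simp add: power2_eq_square)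
    qed
  qed
  show ?thesis
    unfolding eventually_sequentially
  proof (rule exI[of _ "k0\<^sup>2"], intro allI impI)
    fix N assume N: "k0\<^sup>2 \<le> N"
    obtain k where k: "k\<^sup>2 \<le> N" "N < (Suc k)\<^sup>2" using ex by blast
    have "k0 < Suc k"
      using N k by (intro power_less_imp_less_base[of k0 2]) auto
    with k k0[of k] show "\<exists>k. P k \<and> k\<^sup>2 \<le> N \<and> N \<le> (Suc k)\<^sup>2" by auto
  qed
qed

lemma LIMSEQ_square_ratio: "(\<lambda>k. (real (Suc k))\<^sup>2 / (real k)\<^sup>2) \<longlonglongrightarrow> 1"
  using tendsto_power[OF LIMSEQ_Suc_n_over_n, of 2] by (simp add: power_divide)

text \<open>The count at \<open>N\<close> lies between counts at the neighbouring squares with a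
  slightly changed parameter, and consecutive squares have ratio tending to 1. Rational parameters
  are dense, and being countable they give only countably many exceptional sets.\<close>

lemma poissonian_pair_correlation_of_squares:
  assumes lim: "\<And>q. 0 < q \<Longrightarrow>
    (\<lambda>k. real (pair_count y (k\<^sup>2) (real_of_rat q / real (k\<^sup>2))) / real (k\<^sup>2)) \<longlonglongrightarrow> 2 * real_of_rat q"
  shows "poissonian_pair_correlation y"
  unfolding poissonian_pair_correlation_def pair_count_def[symmetric]
proof (intro allI impI order_tendstoI)
  fix s a :: real
  assume s: "0 < s" and a: "2 * s < a"
  \<comment> \<open>The gap from \<open>s\<close> to \<open>q\<close> absorbs the change of radius,
    the gap from \<open>q\<close> to \<open>a / 2\<close> the change of the normalising
    denominator.\<close>
  obtain q where q: "s < real_of_rat q" "real_of_rat q < a / 2"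
    using of_rat_dense[of s "a / 2"] a by auto
  have q0: "0 < q" using q s by (metis less_trans zero_less_of_rat_iff)
  define v where "v k = real (pair_count y (k\<^sup>2) (real_of_rat q / real (k\<^sup>2))) / real (k\<^sup>2)" for k
  have "v \<longlonglongrightarrow> 2 * real_of_rat q"
    using lim[OF q0] by (simp add: v_def[abs_def])
  then have "(\<lambda>k. v (Suc k) * ((real (Suc k))\<^sup>2 / (real k)\<^sup>2)) \<longlonglongrightarrow> 2 * real_of_rat q * 1"
    by (intro tendsto_mult LIMSEQ_Suc LIMSEQ_square_ratio)
  then have "eventually (\<lambda>k. v (Suc k) * ((real (Suc k))\<^sup>2 / (real k)\<^sup>2) < a) sequentially"
    by (rule order_tendstoD) (use q in simp)
  moreover have "eventually (\<lambda>k. (real (Suc k))\<^sup>2 / (real k)\<^sup>2 < real_of_rat q / s) sequentially"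
    using q s by (intro order_tendstoD(2)[OF LIMSEQ_square_ratio]) auto
  ultimately have "eventually (\<lambda>k. v (Suc k) * ((real (Suc k))\<^sup>2 / (real k)\<^sup>2) < a
      \<and> (real (Suc k))\<^sup>2 / (real k)\<^sup>2 < real_of_rat q / s \<and> 1 \<le> k) sequentially"
    using eventually_ge_at_top[of 1] by eventually_elim auto
  from eventually_between_squares[OF this]
  show "eventually (\<lambda>N. real (pair_count y N (s / real N)) / real N < a) sequentially"
  proof eventually_elim
    case (elim N)
    then obtain k where k: "v (Suc k) * ((real (Suc k))\<^sup>2 / (real k)\<^sup>2) < a"
        "(real (Suc k))\<^sup>2 / (real k)\<^sup>2 < real_of_rat q / s" "1 \<le> k" "k\<^sup>2 \<le> N" "N \<le> (Suc k)\<^sup>2"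
      by blast
    have kN: "(real k)\<^sup>2 \<le> real N" "0 < (real k)\<^sup>2"
      using k(3,4) by (simp_all flip: of_nat_power)
    have "s / real N \<le> s / (real k)\<^sup>2"
      using kN s by (intro divide_left_mono mult_pos_pos) linarith+
    also have "\<dots> \<le> real_of_rat q / real ((Suc k)\<^sup>2)"
      using k(2) kN s by (simp add: field_simps)
    finally have "pair_count y N (s / real N) \<le> pair_count y ((Suc k)\<^sup>2) (real_of_rat q / real ((Suc k)\<^sup>2))"
      using k(5) by (intro pair_count_mono)
    then have "real (pair_count y N (s / real N)) / real N
        \<le> real (pair_count y ((Suc k)\<^sup>2) (real_of_rat q / real ((Suc k)\<^sup>2))) / (real k)\<^sup>2"
      using kN by (intro frac_le) auto
    also have "\<dots> = v (Suc k) * ((real (Suc k))\<^sup>2 / (real k)\<^sup>2)"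
      unfolding v_def by simp
    finally show ?case using k(1) by linarith
  qed
next
  fix s a :: real
  assume s: "0 < s" and a: "a < 2 * s"
  \<comment> \<open>The maximum with 0 keeps \<open>q\<close> positive when \<open>a\<close> is
    negative.\<close>
  obtain q where q: "max 0 (a / 2) < real_of_rat q" "real_of_rat q < s"
    using of_rat_dense[of "max 0 (a / 2)" s] a s by auto
  have q0: "0 < q" using q by simp
  define v where "v k = real (pair_count y (k\<^sup>2) (real_of_rat q / real (k\<^sup>2))) / real (k\<^sup>2)" for k
  have "v \<longlonglongrightarrow> 2 * real_of_rat q"
    using lim[OF q0] by (simp add: v_def[abs_def])
  then have "(\<lambda>k. v k / ((real (Suc k))\<^sup>2 / (real k)\<^sup>2)) \<longlonglongrightarrow> 2 * real_of_rat q / 1"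
    by (intro tendsto_divide LIMSEQ_square_ratio) auto
  then have "eventually (\<lambda>k. a < v k / ((real (Suc k))\<^sup>2 / (real k)\<^sup>2)) sequentially"
    by (rule order_tendstoD) (use q in simp)
  moreover have "eventually (\<lambda>k. (real (Suc k))\<^sup>2 / (real k)\<^sup>2 < s / real_of_rat q) sequentially"
    using q q0 by (intro order_tendstoD(2)[OF LIMSEQ_square_ratio]) auto
  ultimately have "eventually (\<lambda>k. a < v k / ((real (Suc k))\<^sup>2 / (real k)\<^sup>2)
      \<and> (real (Suc k))\<^sup>2 / (real k)\<^sup>2 < s / real_of_rat q \<and> 1 \<le> k) sequentially"
    using eventually_ge_at_top[of 1] by eventually_elim auto
  from eventually_between_squares[OF this]
  show "eventually (\<lambda>N. a < real (pair_count y N (s / real N)) / real N) sequentially"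
  proof eventually_elim
    case (elim N)
    then obtain k where k: "a < v k / ((real (Suc k))\<^sup>2 / (real k)\<^sup>2)"
        "(real (Suc k))\<^sup>2 / (real k)\<^sup>2 < s / real_of_rat q" "1 \<le> k" "k\<^sup>2 \<le> N" "N \<le> (Suc k)\<^sup>2"
      by blast
    have kN: "(real k)\<^sup>2 \<le> real N" "0 < (real k)\<^sup>2" "real N \<le> (real (Suc k))\<^sup>2"
      using k(3,4,5) by (simp_all del: of_nat_Suc flip: of_nat_power)
    have "real_of_rat q / real (k\<^sup>2) \<le> s / (real (Suc k))\<^sup>2"
      using k(2) kN q0 by (simp add: field_simps)
    also have "\<dots> \<le> s / real N"
      using kN s by (intro divide_left_mono mult_pos_pos) linarith+
    finally have *: "pair_count y (k\<^sup>2) (real_of_rat q / real (k\<^sup>2)) \<le> pair_count y N (s / real N)"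
      using k(4) by (intro pair_count_mono)
    have "v k / ((real (Suc k))\<^sup>2 / (real k)\<^sup>2)
        = real (pair_count y (k\<^sup>2) (real_of_rat q / real (k\<^sup>2))) / (real (Suc k))\<^sup>2"
      using kN unfolding v_def by simp
    also have "\<dots> \<le> real (pair_count y N (s / real N)) / real N"
      using kN * by (intro frac_le of_nat_mono) linarith+
    finally show ?case using k(1) by linarith
  qed
qed

section \<open>Almost sure convergence along the squares\<close>

context prob_space
begin

text \<open>The variance at \<open>N\<close> is \<open>O(N)\<close>, so the deviation at
  \<open>N = k\<^sup>2\<close>, divided by \<open>N\<close>, has second moment
  \<open>O(1 / k\<^sup>2)\<close>, which is summable.\<close>

lemma AE_pair_count_squares:
  fixes Y :: "nat \<Rightarrow> 'a \<Rightarrow> real"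
  assumes indep: "indep_vars (\<lambda>_. borel) Y {1..}" and s: "0 < s"
    and unif: "\<And>\<epsilon>. 0 < \<epsilon> \<Longrightarrow>
      eventually (\<lambda>N. \<forall>t. \<bar>(\<Sum>l\<in>{1..N}. near_prob Y (s / real N) l t) - 2 * s\<bar> \<le> \<epsilon>) sequentially"
    and diag: "\<And>\<epsilon>. 0 < \<epsilon> \<Longrightarrow>
      eventually (\<lambda>N. \<forall>m\<in>{1..N}. \<forall>t. near_prob Y (s / real N) m t \<le> \<epsilon>) sequentially"
  shows "AE \<omega> in M. (\<lambda>k. real (pair_count (\<lambda>n. Y n \<omega>) (k\<^sup>2) (s / real (k\<^sup>2))) / real (k\<^sup>2)) \<longlonglongrightarrow> 2 * s"
proof -
  define X where "X N \<omega> = (\<Sum>(m, n)\<in>(SIGMA m:{1..N}. {1..N} - {m}).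
    indicator (near_event Y (s / real N) m n) \<omega> :: real)" for N \<omega>
  define e where "e N = expectation (X N)" for N
  have indN: "indep_vars (\<lambda>_. borel) Y {1..N}" for N
    using indep by (rule indep_vars_subset) auto
  \<comment> \<open>This bound holds for every \<open>N\<close>, so integrability and the mean
    formula are available for all \<open>N\<close> and not only eventually.\<close>
  have trivial_bound: "(\<Sum>l\<in>{1..N}. near_prob Y r l t) \<le> real N" for N r t
    using sum_bounded_above[of "{1..N}" "\<lambda>l. near_prob Y r l t" 1] near_prob_le_1 by simp
  have sq_int: "integrable M (\<lambda>\<omega>. (X N \<omega> - e N)\<^sup>2)" for N
    unfolding e_def X_def[abs_def]
    by (rule variance_near_pairs(1)[OF indN _ trivial_bound]) simp
  have e_eq: "e N = (\<Sum>(m, n)\<in>(SIGMA m:{1..N}. {1..N} - {m}). prob (near_event Y (s / real N) m n))" for N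
    unfolding e_def X_def[abs_def]
    by (rule variance_near_pairs(2)[OF indN _ trivial_bound]) simp
  have e_lim: "(\<lambda>N. e N / real N) \<longlonglongrightarrow> 2 * s"
  proof (rule LIMSEQ_I)
    fix \<epsilon> :: real assume "0 < \<epsilon>"
    then have "0 < \<epsilon> / 3" by simp
    have "eventually (\<lambda>N. norm (e N / real N - 2 * s) < \<epsilon>) sequentially"
      using unif[OF \<open>0 < \<epsilon> / 3\<close>] diag[OF \<open>0 < \<epsilon> / 3\<close>] eventually_ge_at_top[of 1]
    proof eventually_elim
      case (elim N)
      have "\<bar>e N - real (card {1..N}) * (2 * s)\<bar> \<le> real (card {1..N}) * (\<epsilon> / 3 + \<epsilon> / 3)"
        unfolding e_eq using elim by (intro sum_prob_near_event_approx[OF indN]) auto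
      then have "\<bar>e N / real N - 2 * s\<bar> \<le> \<epsilon> / 3 + \<epsilon> / 3"
        using elim(3) by (simp add: abs_le_iff field_simps)
      with \<open>0 < \<epsilon>\<close> show ?case by simp
    qed
    then show "\<exists>no. \<forall>n\<ge>no. norm (e n / real n - 2 * s) < \<epsilon>"
      by (simp add: eventually_sequentially)
  qed
  \<comment> \<open>\<open>C\<close> bounds the sum of near probabilities through
    \<open>unif\<close> with error 1, and eventually also \<open>e N / N\<close>, whose limit is
    \<open>2 * s\<close>.\<close>
  define C where "C = 2 * s + 1"
  have C: "0 < C" and C_gt: "2 * s < C" using s by (simp_all add: C_def)
  have var: "eventually (\<lambda>N. expectation (\<lambda>\<omega>. (X N \<omega> - e N)\<^sup>2) \<le> 4 * (C + 1) * C * real N) sequentially"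
    using unif[OF zero_less_one] order_tendstoD(2)[OF e_lim, of C, OF C_gt] eventually_ge_at_top[of 1]
  proof eventually_elim
    case (elim N)
    have "(\<Sum>l\<in>{1..N}. near_prob Y (s / real N) l t) \<le> C" for t
      using elim(1)[rule_format, of t] by (simp add: C_def abs_le_iff)
    then have "expectation (\<lambda>\<omega>. (X N \<omega> - e N)\<^sup>2) \<le> 4 * (C + 1) * e N"
      unfolding e_def X_def[abs_def] by (intro variance_near_pairs(3)[OF indN]) auto
    also have "\<dots> \<le> 4 * (C + 1) * (C * real N)"
      using elim(2,3) C by (intro mult_left_mono) (auto simp: field_simps)
    finally show ?case by (simp add: mult.assoc)
  qed
  define Z where "Z k \<omega> = (X (k\<^sup>2) \<omega> - e (k\<^sup>2)) / real (k\<^sup>2)" for k \<omega>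
  have squares: "filterlim (\<lambda>k::nat. k\<^sup>2) at_top sequentially"
    by (rule filterlim_at_top_mono[OF filterlim_ident]) (auto simp: power2_eq_square)
  have "AE \<omega> in M. (\<lambda>k. Z k \<omega>) \<longlonglongrightarrow> 0"
  proof (rule AE_tendsto_zero_of_summable_second_moments)
    show "integrable M (\<lambda>\<omega>. (Z k \<omega>)\<^sup>2)" for k
      unfolding Z_def power_divide using sq_int by simp
    have "eventually (\<lambda>k. norm (expectation (\<lambda>\<omega>. (Z k \<omega>)\<^sup>2)) \<le> 4 * (C + 1) * C * (1 / real k ^ 2)) sequentially"
      using filterlim_iff[THEN iffD1, OF squares, rule_format, OF var] eventually_ge_at_top[of 1]
    proof eventually_elim
      case (elim k)
      have "expectation (\<lambda>\<omega>. (Z k \<omega>)\<^sup>2) = expectation (\<lambda>\<omega>. (X (k\<^sup>2) \<omega> - e (k\<^sup>2))\<^sup>2) / (real (k\<^sup>2))\<^sup>2"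
        unfolding Z_def power_divide by simp
      also have "\<dots> \<le> 4 * (C + 1) * C * real (k\<^sup>2) / (real (k\<^sup>2))\<^sup>2"
        using elim(1) by (intro divide_right_mono) auto
      also have "\<dots> = 4 * (C + 1) * C * (1 / real k ^ 2)"
        using elim(2) by (simp add: power2_eq_square field_simps)
      finally show ?case
        by simp
    qed
    moreover have "summable (\<lambda>k. 4 * (C + 1) * C * (1 / real k ^ 2))"
      using inverse_power_summable[of 2, where 'a = real] by (intro summable_mult) (simp add: inverse_eq_divide)
    ultimately show "summable (\<lambda>k. expectation (\<lambda>\<omega>. (Z k \<omega>)\<^sup>2))"
      by (rule summable_comparison_test_ev)
  qed
  then show ?thesis
    using AE_space
  proof eventually_elim
    case (elim \<omega>)
    have X_eq: "X N \<omega> = real (pair_count (\<lambda>n. Y n \<omega>) N (s / real N))" for N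
    proof -
      define S where "S = (SIGMA m:{1..N}. {1..N} - {m})"
      have "X N \<omega> = (\<Sum>p\<in>S. of_bool (dist_int (Y (fst p) \<omega> - Y (snd p) \<omega>) < s / real N))"
        unfolding X_def S_def using elim(2)
        by (intro sum.cong) (auto simp: near_event_def indicator_def)
      also have "\<dots> = real (card (S \<inter> {p. dist_int (Y (fst p) \<omega> - Y (snd p) \<omega>) < s / real N}))"
        by (simp add: of_bool_def sum.If_cases S_def)
      also have "S \<inter> {p. dist_int (Y (fst p) \<omega> - Y (snd p) \<omega>) < s / real N}
          = {(m, n). m \<in> {1..N} \<and> n \<in> {1..N} \<and> m \<noteq> n \<and> dist_int (Y m \<omega> - Y n \<omega>) < s / real N}"
        by (auto simp: S_def)
      finally show ?thesis by (simp add: pair_count_def)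
    qed
    have "(\<lambda>k. Z k \<omega> + e (k\<^sup>2) / real (k\<^sup>2)) \<longlonglongrightarrow> 0 + 2 * s"
      using elim(1) filterlim_compose[OF e_lim squares] by (intro tendsto_add)
    then show ?case
      by (simp add: Z_def X_eq diff_divide_distrib)
  qed
qed

text \<open>Density bounds uniform in the argument thus become probability bounds, by integration
  over a window of length \<open>2 * r\<close>.\<close>

lemma near_prob_smeared:
  fixes x :: "nat \<Rightarrow> real" and g :: "real \<Rightarrow> real" and z :: "nat \<Rightarrow> 'a \<Rightarrow> real"
  assumes z [measurable]: "z n \<in> borel_measurable M"
    and distr: "distr M borel (z n) = uniform_measure lborel {- g (real n)..g (real n)}"
    and gn: "0 < g (real n)" and r: "0 < r" "r \<le> 1 / 2"
  shows "near_prob (\<lambda>n \<omega>. x n + z n \<omega>) r n t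
    = (\<integral>v. indicator {- r<..<r} v * smeared_density x g n (t + v) \<partial>lborel)"
proof -
  have "near_prob (\<lambda>n \<omega>. x n + z n \<omega>) r n t = prob (z n -` {y. dist_int (y - (t - x n)) < r} \<inter> space M)"
    unfolding near_prob_def by (intro arg_cong[where f = prob]) (auto simp: algebra_simps)
  also have "\<dots> = measure (distr M borel (z n)) {y. dist_int (y - (t - x n)) < r}"
    by (rule measure_distr[symmetric]) measurable
  also have "\<dots> = (\<integral>v. indicator {- r<..<r} v * smeared_density x g n (t + v) \<partial>lborel)"
    unfolding distr measure_uniform_dist_int[OF gn r] smeared_density_def by (simp add: algebra_simps)
  finally show ?thesis .
qed

end

lemma integrable_indicator_smeared_density:
  assumes "0 < g (real n)"
  shows "integrable lborel (\<lambda>v. indicator {- r<..<r} v * smeared_density x g n (t + v))"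
proof -
  have "integrable lborel (\<lambda>v. indicator {- r<..<r} v * cover (g (real n)) (t - x n + v) / (2 * g (real n)))"
    using integrable_indicator_cover[of "g (real n)" r "t - x n"] assms by simp
  then show ?thesis
    by (simp add: smeared_density_def algebra_simps)
qed

lemma integral_indicator_bounds:
  fixes f :: "real \<Rightarrow> real"
  assumes int: "integrable lborel (\<lambda>v. indicator {- r<..<r} v * f v)" and r: "0 \<le> r"
  shows "(\<And>v. f v \<le> b) \<Longrightarrow> (\<integral>v. indicator {- r<..<r} v * f v \<partial>lborel) \<le> 2 * r * b"
    and "(\<And>v. a \<le> f v) \<Longrightarrow> 2 * r * a \<le> (\<integral>v. indicator {- r<..<r} v * f v \<partial>lborel)"
proof -
  have c: "integrable lborel (\<lambda>v. indicator {- r<..<r} v * b)"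
      "(\<integral>v. indicator {- r<..<r} v * b \<partial>lborel) = 2 * r * b" for b :: real
    using r by auto
  show "(\<integral>v. indicator {- r<..<r} v * f v \<partial>lborel) \<le> 2 * r * b" if "\<And>v. f v \<le> b"
    unfolding c(2)[symmetric] using that by (intro integral_mono int c mult_left_mono) auto
  show "2 * r * a \<le> (\<integral>v. indicator {- r<..<r} v * f v \<partial>lborel)" if "\<And>v. a \<le> f v"
    unfolding c(2)[symmetric] using that by (intro integral_mono int c mult_left_mono) auto
qed

theorem theorem2:
  fixes x :: "nat \<Rightarrow> real" and g :: "real \<Rightarrow> real"
    and M :: "'a measure" and z :: "nat \<Rightarrow> 'a \<Rightarrow> real"
  assumes g_pos: "\<forall>t>0. g t > 0"
    and g_decr: "\<forall>s t. 0 < s \<longrightarrow> s \<le> t \<longrightarrow> g t \<le> g s"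
    and lim1: "filterlim (\<lambda>N. g (real N) / discrepancy x N) at_top sequentially"
    and lim2: "filterlim (\<lambda>N. real N * g (real N)) at_top sequentially"
    and lim3: "(\<lambda>N. g (real N * (1 + max_nD x N / (real N * g (real N)))) / g (real N))
                 \<longlonglongrightarrow> 1"
    and prob: "prob_space M"
    and indep: "prob_space.indep_vars M (\<lambda>_. borel) z {1..}"
    and unif: "\<And>i. i \<ge> 1 \<Longrightarrow>
                 distr M borel (z i) = uniform_measure lborel {- g (real i) .. g (real i)}"
  shows "AE \<omega> in M. poissonian_pair_correlation (\<lambda>n. x n + z n \<omega>)"
proof -
  interpret prob_space M by (rule prob)
  define Y where "Y = (\<lambda>n \<omega>. x n + z n \<omega>)"
  have indepY: "indep_vars (\<lambda>_. borel) Y {1..}"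
    unfolding Y_def by (rule indep_vars_compose2[OF indep]) measurable
  have zm: "z n \<in> borel_measurable M" if "1 \<le> n" for n
    using indep that by (auto simp: indep_vars_def)
  have gp: "0 < g (real n)" if "1 \<le> n" for n
    using g_pos that by simp
  have near: "near_prob Y r n t = (\<integral>v. indicator {- r<..<r} v * smeared_density x g n (t + v) \<partial>lborel)"
    if "1 \<le> n" "0 < r" "r \<le> 1 / 2" for n r t
    unfolding Y_def using that zm unif gp by (intro near_prob_smeared) auto
  have sq: "AE \<omega> in M. (\<lambda>k. real (pair_count (\<lambda>n. Y n \<omega>) (k\<^sup>2) (s / real (k\<^sup>2))) / real (k\<^sup>2)) \<longlonglongrightarrow> 2 * s"
    if s: "0 < s" for s
  proof (rule AE_pair_count_squares[OF indepY s])
    \<comment> \<open>The integral formula for \<open>near_prob\<close> requires a radius at most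
      1/2.\<close>
    have small_r: "eventually (\<lambda>N. 1 \<le> N \<and> 0 < s / real N \<and> s / real N \<le> 1 / 2) sequentially"
      using eventually_ge_at_top[of "nat \<lceil>2 * s\<rceil> + 1"]
    proof eventually_elim
      case (elim N)
      then have "2 * s \<le> real N" "1 \<le> N" by linarith+
      with s show ?case by (simp add: field_simps)
    qed
    fix \<epsilon> :: real assume \<epsilon>: "0 < \<epsilon>"
    show "eventually (\<lambda>N. \<forall>t. \<bar>(\<Sum>l\<in>{1..N}. near_prob Y (s / real N) l t) - 2 * s\<bar> \<le> \<epsilon>) sequentially"
    proof -
      \<comment> \<open>This is the relative error allowed for the density; integrating over a
        window of length \<open>2 * s / N\<close> turns it into the absolute error
        \<open>\<epsilon>\<close>.\<close>
      have "0 < \<epsilon> / (2 * s)" using \<epsilon> s by simp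
      note max_nD_small[OF g_pos g_decr lim1 lim2 lim3]
      from sum_smeared_density_uniform[OF g_pos g_decr this \<open>0 < \<epsilon> / (2 * s)\<close>] have
        "eventually (\<lambda>N. \<forall>t. \<bar>(\<Sum>n\<in>{1..N}. smeared_density x g n t) - real N\<bar> \<le> \<epsilon> / (2 * s) * real N) sequentially"
        by simp
      then show ?thesis
        using small_r
      proof eventually_elim
        case (elim N)
        show ?case
        proof
          fix t
          define r where "r = s / real N"
          have r: "0 < r" "r \<le> 1 / 2" "real N * r = s" using elim(2) by (auto simp: r_def)
          define F where "F v = (\<Sum>l\<in>{1..N}. smeared_density x g l (t + v))" for v
          have int1: "integrable lborel (\<lambda>v. indicator {- r<..<r} v * smeared_density x g l (t + v))"
            if "l \<in> {1..N}" for l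
            using that gp by (intro integrable_indicator_smeared_density) auto
          have "(\<Sum>l\<in>{1..N}. near_prob Y r l t)
              = (\<Sum>l\<in>{1..N}. \<integral>v. indicator {- r<..<r} v * smeared_density x g l (t + v) \<partial>lborel)"
            using r by (intro sum.cong refl near) auto
          also have "\<dots> = (\<integral>v. (\<Sum>l\<in>{1..N}. indicator {- r<..<r} v * smeared_density x g l (t + v)) \<partial>lborel)"
            using int1 by (intro Bochner_Integration.integral_sum[symmetric])
          finally have eq: "(\<Sum>l\<in>{1..N}. near_prob Y r l t) = (\<integral>v. indicator {- r<..<r} v * F v \<partial>lborel)"
            by (simp add: F_def sum_distrib_left)
          have int: "integrable lborel (\<lambda>v. indicator {- r<..<r} v * F v)"
            unfolding F_def sum_distrib_left using int1 by (intro Bochner_Integration.integrable_sum)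
          have F: "F v \<le> (1 + \<epsilon> / (2 * s)) * real N" "(1 - \<epsilon> / (2 * s)) * real N \<le> F v" for v
            using elim(1)[rule_format, of "t + v"] unfolding F_def[symmetric] abs_le_iff
            by (simp_all only: left_diff_distrib distrib_right) linarith+
          have "(\<integral>v. indicator {- r<..<r} v * F v \<partial>lborel) \<le> 2 * r * ((1 + \<epsilon> / (2 * s)) * real N)"
            using F r by (intro integral_indicator_bounds int) auto
          also have "\<dots> = 2 * (1 + \<epsilon> / (2 * s)) * (real N * r)" by simp
          also have "\<dots> = 2 * s + \<epsilon>" unfolding r(3) using s by (simp add: field_simps)
          finally have up: "(\<Sum>l\<in>{1..N}. near_prob Y r l t) \<le> 2 * s + \<epsilon>" unfolding eq .
          have "2 * s - \<epsilon> = 2 * (1 - \<epsilon> / (2 * s)) * (real N * r)" unfolding r(3) using s by (simp add: field_simps)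
          also have "\<dots> = 2 * r * ((1 - \<epsilon> / (2 * s)) * real N)" by simp
          also have "\<dots> \<le> (\<integral>v. indicator {- r<..<r} v * F v \<partial>lborel)"
            using F r by (intro integral_indicator_bounds int) auto
          finally show "\<bar>(\<Sum>l\<in>{1..N}. near_prob Y (s / real N) l t) - 2 * s\<bar> \<le> \<epsilon>"
            using up unfolding eq[symmetric] r_def[symmetric] by linarith
        qed
      qed
    qed
    show "eventually (\<lambda>N. \<forall>m\<in>{1..N}. \<forall>t. near_prob Y (s / real N) m t \<le> \<epsilon>) sequentially"
    proof -
      \<comment> \<open>Each density is at most \<open>1 + 1 / (2 * g N)\<close>, which bounds the
        probability by \<open>2 * s / N + s / (N * g N)\<close>. The two thresholds make each
        summand at most \<open>\<epsilon> / 2\<close>.\<close>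
      have "eventually (\<lambda>N. 2 * s / \<epsilon> \<le> real N * g (real N)) sequentially"
        using lim2 by (simp add: filterlim_at_top)
      moreover have "eventually (\<lambda>N. 4 * s / \<epsilon> \<le> real N) sequentially"
        using filterlim_real_sequentially by (simp add: filterlim_at_top)
      ultimately show ?thesis
        using small_r
      proof eventually_elim
        case (elim N)
        show ?case
        proof (intro ballI allI)
          fix m t assume m: "m \<in> {1..N}"
          define r where "r = s / real N"
          have r: "0 < r" "r \<le> 1 / 2" using elim(3) by (auto simp: r_def)
          have g: "0 < g (real N)" "g (real N) \<le> g (real m)" "0 < g (real m)"
            using m gp g_decr by auto
          have "smeared_density x g m u \<le> 1 + 1 / (2 * g (real N))" for u
          proof -
            have "smeared_density x g m u \<le> (2 * g (real m) + 1) / (2 * g (real m))"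
              unfolding smeared_density_def using g by (intro divide_right_mono cover_upper) auto
            also have "\<dots> = 1 + 1 / (2 * g (real m))" using g by (simp add: field_simps)
            also have "\<dots> \<le> 1 + 1 / (2 * g (real N))" using g by (intro add_left_mono divide_left_mono) auto
            finally show ?thesis .
          qed
          then have "near_prob Y r m t \<le> 2 * r * (1 + 1 / (2 * g (real N)))"
            using m r g by (subst near) (auto intro!: integral_indicator_bounds integrable_indicator_smeared_density)
          also have "\<dots> = 2 * s / real N + s / (real N * g (real N))"
            unfolding r_def using g elim(3) by (simp add: field_simps)
          also have "\<dots> \<le> \<epsilon> / 2 + \<epsilon> / 2"
          proof (rule add_mono)
            show "2 * s / real N \<le> \<epsilon> / 2" using elim(2,3) \<epsilon> by (simp add: field_simps)
            have "0 < real N * g (real N)" using g elim(3) by simp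
            then show "s / (real N * g (real N)) \<le> \<epsilon> / 2"
              using elim(1) \<epsilon> by (simp add: divide_le_eq pos_divide_le_eq mult.commute)
          qed
          finally show "near_prob Y (s / real N) m t \<le> \<epsilon>" unfolding r_def by simp
        qed
      qed
    qed
  qed
  \<comment> \<open>Each rational \<open>q\<close> has its own null set, and countably many can be
    discarded together.\<close>
  have "AE \<omega> in M. \<forall>q::rat. 0 < q \<longrightarrow>
      (\<lambda>k. real (pair_count (\<lambda>n. Y n \<omega>) (k\<^sup>2) (real_of_rat q / real (k\<^sup>2))) / real (k\<^sup>2)) \<longlonglongrightarrow> 2 * real_of_rat q"
    unfolding AE_all_countable
  proof
    fix q :: rat
    show "AE \<omega> in M. 0 < q \<longrightarrow>
      (\<lambda>k. real (pair_count (\<lambda>n. Y n \<omega>) (k\<^sup>2) (real_of_rat q / real (k\<^sup>2))) / real (k\<^sup>2)) \<longlonglongrightarrow> 2 * real_of_rat q"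
      using sq[of "real_of_rat q"] by (cases "0 < q") auto
  qed
  then show ?thesis
    unfolding Y_def
    by eventually_elim (rule poissonian_pair_correlation_of_squares, blast)
qed

end
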